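(* Let $\lambda,t\in\mathbb{C}$ with $0,1,\lambda,t$ pairwise distinct, and let $\Gamma\subset\mathbb{P}^1_z\times\mathbb{P}^1_w$ be the smooth bidegree $(2,2)$ curve $$t^{2} z^{2} - 2 t z^{2} w + t^{2} w^{2} - 2 t z w^{2} + z^{2} w^{2} - 2 \lambda t z - 2 \lambda t w + 2\left(2(\lambda+1)t - t^{2} - \lambda\right) z w + \lambda^{2}=0 .$$ Then the group $\mathrm{Aut}(\mathbb{P}^1_z\times\mathbb{P}^1_w,\Gamma)$ of automorphisms of $\mathbb{P}^1_z\times\mathbb{P}^1_w$ leaving $\Gamma$ invariant is isomorphic to $(\mathbb{Z}/2\mathbb{Z})^3$, and it is generated by the involutions $\tilde\sigma_k$ ($k\in\{0,1,\lambda,\infty\}$) and $\phi_T$.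
   Context: Work over $\mathbb{C}$; $z,w$ are affine coordinates on the two factors. Put $\beta_\infty=\mathrm{id}$, $\beta_0(x)=\lambda/x$, $\beta_1(x)=\frac{x-\lambda}{x-1}$, $\beta_\lambda(x)=\frac{\lambda x-\lambda}{x-\lambda}$. Then $\tilde\sigma_k(z,w)=(\beta_k(z),\beta_k(w))$ and $\phi_T(z,w)=(w,z)$. (Modularly, $\mathbb{P}^1_z\times\mathbb{P}^1_w$ is the moduli space of semistable rank $2$ parabolic bundles with trivial determinant and weights $(\mu,\mu)$, $0<\mu<1$, over $(C,T)$, with $C:y^2=x(x-1)(x-\lambda)$ and $T$ the preimage of $t$ under $(x,y)\mapsto x$; $\Gamma$ is the strictly semistable locus; $\tilde\sigma_k$ is the twist by the $2$-torsion line bundle $\mathcal O_C(w_k-w_\infty)$, $w_k$ the point over $k$; $\phi_T$ is the positive elementary transformation over $T$ followed by twist by $\mathcal O_C(-w_\infty)$.)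
   Formalization: Excluded, since the claim fails there: t²=λ, (t−1)²=1−λ, (t−λ)²=λ²−λ, or λ²−λ+1=0 with t∈{(1+λ)/3, 1+λ, λ−1, 1−λ}. E.g. for t²=λ the map (z,w)↦(z,λ/w) preserves Γ but does not commute with φ_T. For each excluded pair the group is not (Z/2)³. *)

theory Defs
  imports Complex_Main "HOL-Algebra.Elementary_Groups"
begin

section \<open>The variety \<open>P\<^sup>1 \<times> P\<^sup>1\<close> and its automorphisms\<close>

text \<open>The complex projective line as the affine line together with one point at infinity.\<close>

datatype P1 = Aff complex | Infty

fun hcoord :: "P1 \<Rightarrow> complex \<times> complex" where
  "hcoord (Aff x) = (x, 1)"
| "hcoord Infty = (1, 0)"

text \<open>\<open>point X Y\<close> is the point with homogeneous coordinates \<open>[X : Y]\<close>; it is only meaningful for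
  \<open>(X, Y) \<noteq> (0, 0)\<close>.\<close>

definition point :: "complex \<Rightarrow> complex \<Rightarrow> P1" where
  "point X Y = (if Y = 0 then Infty else Aff (X / Y))"

type_synonym biform = "complex \<times> complex \<Rightarrow> complex \<times> complex \<Rightarrow> complex"

definition biforms :: "nat \<Rightarrow> nat \<Rightarrow> biform set" where
  "biforms a b = {F. \<exists>c. \<forall>x0 x1 y0 y1. F (x0, x1) (y0, y1) =
     (\<Sum>i\<le>a. \<Sum>j\<le>b. c i j * (x0 ^ i * x1 ^ (a - i)) * (y0 ^ j * y1 ^ (b - j)))}"

text \<open>The value of a biform at a point depends on the representatives chosen by \<^const>\<open>hcoord\<close>, but
  its vanishing, and the ratio of two biforms of the same bidegree, do not.\<close>

definition at_pt :: "biform \<Rightarrow> P1 \<times> P1 \<Rightarrow> complex" where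
  "at_pt F p = F (hcoord (fst p)) (hcoord (snd p))"

text \<open>A map to \<open>P\<^sup>1\<close> is regular if Zariski-locally it is \<open>[F : G]\<close> for two biforms of equal bidegree
  without common zero; the non-vanishing loci of biforms \<open>H\<close> are a basis of the Zariski topology.\<close>

definition regular_map :: "(P1 \<times> P1 \<Rightarrow> P1) \<Rightarrow> bool" where
  "regular_map f \<longleftrightarrow> (\<forall>p. \<exists>a b c d. \<exists>F\<in>biforms a b. \<exists>G\<in>biforms a b. \<exists>H\<in>biforms c d.
     at_pt H p \<noteq> 0 \<and>
     (\<forall>q. at_pt H q \<noteq> 0 \<longrightarrow>
        (at_pt F q, at_pt G q) \<noteq> (0, 0) \<and> f q = point (at_pt F q) (at_pt G q)))"

definition morphism :: "(P1 \<times> P1 \<Rightarrow> P1 \<times> P1) \<Rightarrow> bool" where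
  "morphism f \<longleftrightarrow> regular_map (fst \<circ> f) \<and> regular_map (snd \<circ> f)"

definition automorphism :: "(P1 \<times> P1 \<Rightarrow> P1 \<times> P1) \<Rightarrow> bool" where
  "automorphism f \<longleftrightarrow> bij f \<and> morphism f \<and> morphism (inv_into UNIV f)"

definition Aut_pair :: "(P1 \<times> P1) set \<Rightarrow> (P1 \<times> P1 \<Rightarrow> P1 \<times> P1) monoid" where
  "Aut_pair S = \<lparr>carrier = {f. automorphism f \<and> f ` S = S}, monoid.mult = (\<circ>), one = id\<rparr>"


section \<open>The curve and the involutions\<close>

text \<open>Bihomogenisation (\<open>z = z0 / z1\<close>, \<open>w = w0 / w1\<close>) of the affine equation; see \<open>Gamma_affine\<close>.\<close>

definition gamma_form :: "complex \<Rightarrow> complex \<Rightarrow> biform" where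
  "gamma_form lam t = (\<lambda>(z0, z1) (w0, w1).
     t^2 * z0^2 * w1^2 - 2 * t * z0^2 * w0 * w1 + t^2 * z1^2 * w0^2 - 2 * t * z0 * z1 * w0^2
     + z0^2 * w0^2 - 2 * lam * t * z0 * z1 * w1^2 - 2 * lam * t * z1^2 * w0 * w1
     + 2 * (2 * (lam + 1) * t - t^2 - lam) * z0 * z1 * w0 * w1 + lam^2 * z1^2 * w1^2)"

definition Gamma :: "complex \<Rightarrow> complex \<Rightarrow> (P1 \<times> P1) set" where
  "Gamma lam t = {p. at_pt (gamma_form lam t) p = 0}"

text \<open>\<open>moebius a b c d\<close> is \<open>x \<mapsto> (a x + b) / (c x + d)\<close>, extended to all of \<^typ>\<open>P1\<close>.\<close>

definition moebius :: "complex \<Rightarrow> complex \<Rightarrow> complex \<Rightarrow> complex \<Rightarrow> P1 \<Rightarrow> P1" where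
  "moebius a b c d p = (case hcoord p of (x0, x1) \<Rightarrow> point (a * x0 + b * x1) (c * x0 + d * x1))"

text \<open>Only used for distinct \<open>0, 1, lam\<close> and for an index among \<open>0, 1, lam, \<infinity>\<close>.\<close>

definition beta :: "complex \<Rightarrow> P1 \<Rightarrow> P1 \<Rightarrow> P1" where
  "beta lam k =
     (if k = Infty then id
      else if k = Aff 0 then moebius 0 lam 1 0
      else if k = Aff 1 then moebius 1 (- lam) 1 (- 1)
      else if k = Aff lam then moebius lam (- lam) 1 (- lam)
      else undefined)"

definition sigma :: "complex \<Rightarrow> P1 \<Rightarrow> P1 \<times> P1 \<Rightarrow> P1 \<times> P1" where
  "sigma lam k = (\<lambda>(z, w). (beta lam k z, beta lam k w))"

definition phi_T :: "P1 \<times> P1 \<Rightarrow> P1 \<times> P1" where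
  "phi_T = (\<lambda>(z, w). (w, z))"

definition Z2_cubed :: "(int \<times> int \<times> int) monoid" where
  "Z2_cubed = integer_mod_group 2 \<times>\<times> integer_mod_group 2 \<times>\<times> integer_mod_group 2"

text \<open>Parameters for which \<open>Gamma\<close> has additional symmetries: either \<open>t\<close> is fixed by some
  \<open>beta lam k\<close> with \<open>k \<noteq> \<infinity>\<close> (the points of \<open>C\<close> over \<open>t\<close> are 4-torsion), or \<open>C\<close> has
  \<open>j\<close>-invariant 0 and an automorphism of order 3 of \<open>C\<close> preserves the double of the points over
  \<open>t\<close>. Lemma \<open>exceptional_not_iso\<close> below shows that these parameters have to be excluded from
  the computation of \<open>Aut_pair (Gamma lam t)\<close>.\<close>

definition exceptional :: "complex \<Rightarrow> complex \<Rightarrow> bool" where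
  "exceptional lam t \<longleftrightarrow>
     t^2 = lam \<or> (t - 1)^2 = 1 - lam \<or> (t - lam)^2 = lam^2 - lam \<or>
     (lam^2 - lam + 1 = 0 \<and> t \<in> {(1 + lam) / 3, 1 + lam, lam - 1, 1 - lam})"


section \<open>Consistency with the affine formulas\<close>

lemma Gamma_affine:
  "(Aff z, Aff w) \<in> Gamma lam t \<longleftrightarrow>
     t^2 * z^2 - 2 * t * z^2 * w + t^2 * w^2 - 2 * t * z * w^2 + z^2 * w^2
     - 2 * lam * t * z - 2 * lam * t * w + 2 * (2 * (lam + 1) * t - t^2 - lam) * z * w + lam^2 = 0"
  by (simp add: Gamma_def at_pt_def gamma_form_def)

lemma gamma_form_biform: "gamma_form lam t \<in> biforms 2 2"
proof -
  define c :: "nat \<Rightarrow> nat \<Rightarrow> complex" where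
    "c i j = (if (i, j) = (2, 0) then t^2 else if (i, j) = (2, 1) then - 2 * t
       else if (i, j) = (0, 2) then t^2 else if (i, j) = (1, 2) then - 2 * t
       else if (i, j) = (2, 2) then 1 else if (i, j) = (1, 0) then - 2 * lam * t
       else if (i, j) = (0, 1) then - 2 * lam * t
       else if (i, j) = (1, 1) then 2 * (2 * (lam + 1) * t - t^2 - lam) else lam^2)" for i j
  have "gamma_form lam t (x0, x1) (y0, y1) =
      (\<Sum>i\<le>2. \<Sum>j\<le>2. c i j * (x0 ^ i * x1 ^ (2 - i)) * (y0 ^ j * y1 ^ (2 - j)))" for x0 x1 y0 y1
    by (simp add: gamma_form_def c_def numeral_2_eq_2 algebra_simps)
  then show ?thesis
    unfolding biforms_def by blast
qed

lemma beta_affine: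
  "x \<noteq> 0 \<Longrightarrow> beta lam (Aff 0) (Aff x) = Aff (lam / x)"
  "x \<noteq> 1 \<Longrightarrow> beta lam (Aff 1) (Aff x) = Aff ((x - lam) / (x - 1))"
  "\<lbrakk>lam \<noteq> 0; lam \<noteq> 1; x \<noteq> lam\<rbrakk> \<Longrightarrow>
     beta lam (Aff lam) (Aff x) = Aff ((lam * x - lam) / (x - lam))"
  by (auto simp: beta_def moebius_def point_def)


section \<open>Additional symmetries for exceptional parameters\<close>

lemma moebius_hcoord_nonzero:
  assumes "a * d - b * c \<noteq> 0"
  shows "(a * fst (hcoord p) + b * snd (hcoord p), c * fst (hcoord p) + d * snd (hcoord p))
    \<noteq> (0, 0)"
proof
  assume "(a * fst (hcoord p) + b * snd (hcoord p), c * fst (hcoord p) + d * snd (hcoord p)) = (0, 0)"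
  then have "a * fst (hcoord p) + b * snd (hcoord p) = 0" "c * fst (hcoord p) + d * snd (hcoord p) = 0"
    by simp_all
  then have "(a * d - b * c) * fst (hcoord p) = 0" "(a * d - b * c) * snd (hcoord p) = 0"
    by algebra+
  then show False
    using assms by (cases p) auto
qed

lemma moebius_inverse:
  assumes "a * d - b * c \<noteq> 0"
  shows "moebius d (- b) (- c) a (moebius a b c d p) = p"
proof (cases p)
  case (Aff x)
  show ?thesis
  proof (cases "c * x + d = 0")
    case True
    then have d: "d = - c * x"
      by algebra
    have "c \<noteq> 0" using assms d by auto
    then show ?thesis using Aff True d by (simp add: moebius_def point_def)
  next
    case False
    have 1: "a - c * (a * x + b) / (c * x + d) = (a * d - b * c) / (c * x + d)"
      using False by (simp add: field_simps)
    have 2: "d * (a * x + b) / (c * x + d) - b = (a * d - b * c) * x / (c * x + d)"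
      using False by (simp add: field_simps)
    have "moebius d (- b) (- c) a (moebius a b c d p) =
        point (d * (a * x + b) / (c * x + d) - b) (a - c * (a * x + b) / (c * x + d))"
      using Aff False by (simp add: moebius_def point_def)
    also have "\<dots> = Aff x"
      unfolding 1 2 using False assms by (simp add: point_def)
    finally show ?thesis using Aff by simp
  qed
next
  case Infty
  then show ?thesis using assms
    by (auto simp: moebius_def point_def field_simps)
qed

lemma moebius_regular:
  assumes "a * d - b * c \<noteq> 0"
  shows "regular_map (\<lambda>p. moebius a b c d (fst p))" "regular_map (\<lambda>p. moebius a b c d (snd p))"
proof -
  note nz = moebius_hcoord_nonzero[OF assms]
  have one: "(\<lambda>_ _. 1) \<in> biforms 0 0"
    by (auto simp: biforms_def)
  have lin1: "(\<lambda>x y. e * fst x + f * snd x) \<in> biforms 1 0" for e f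
    unfolding biforms_def mem_Collect_eq
    by (rule exI[of _ "\<lambda>i j. if i = 0 then f else e"]) simp
  have lin2: "(\<lambda>x y. e * fst y + f * snd y) \<in> biforms 0 1" for e f
    unfolding biforms_def mem_Collect_eq
    by (rule exI[of _ "\<lambda>i j. if j = 0 then f else e"]) simp
  show "regular_map (\<lambda>p. moebius a b c d (fst p))"
    unfolding regular_map_def
    apply (intro allI)
    apply (rule exI[of _ 1], rule exI[of _ 0], rule exI[of _ 0], rule exI[of _ 0])
    apply (rule bexI[OF _ lin1[of a b]], rule bexI[OF _ lin1[of c d]], rule bexI[OF _ one])
    using nz by (auto simp: at_pt_def moebius_def split: prod.splits)
  show "regular_map (\<lambda>p. moebius a b c d (snd p))"
    unfolding regular_map_def
    apply (intro allI)
    apply (rule exI[of _ 0], rule exI[of _ 1], rule exI[of _ 0], rule exI[of _ 0])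
    apply (rule bexI[OF _ lin2[of a b]], rule bexI[OF _ lin2[of c d]], rule bexI[OF _ one])
    using nz by (auto simp: at_pt_def moebius_def split: prod.splits)
qed

lemma automorphism_moebius:
  assumes "a * d - b * c \<noteq> 0" "a' * d' - b' * c' \<noteq> 0"
  shows "automorphism (map_prod (moebius a b c d) (moebius a' b' c' d'))" (is "automorphism ?f")
proof -
  let ?g = "map_prod (moebius d (- b) (- c) a) (moebius d' (- b') (- c') a')"
  have adj: "d * a - - b * - c \<noteq> 0" "d' * a' - - b' * - c' \<noteq> 0"
    using assms by (simp_all add: mult.commute)
  have gf: "?g (?f p) = p" for p
    using moebius_inverse[OF assms(1)] moebius_inverse[OF assms(2)] by (cases p) simp
  have fg: "?f (?g p) = p" for p
    using moebius_inverse[OF adj(1)] moebius_inverse[OF adj(2)] by (cases p) simp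
  have bij: "bij ?f"
    by (rule o_bij[of ?g]) (simp_all only: fun_eq_iff comp_apply id_apply gf fg simp_thms)
  have "inv_into UNIV ?f = ?g"
    by (rule inv_equality) (use gf fg in auto)
  moreover have "morphism ?f" "morphism ?g"
    unfolding morphism_def comp_def fst_map_prod snd_map_prod
    using moebius_regular[OF assms(1)] moebius_regular[OF assms(2)]
      moebius_regular[OF adj(1)] moebius_regular[OF adj(2)] by auto
  ultimately show ?thesis
    using bij by (simp add: automorphism_def)
qed

lemma point_in_Gamma:
  assumes "(X, Y) \<noteq> (0, 0)" "(X', Y') \<noteq> (0, 0)"
  shows "(point X Y, point X' Y') \<in> Gamma lam t \<longleftrightarrow> gamma_form lam t (X, Y) (X', Y') = 0"
proof -
  have scale: "gamma_form lam t (s * x0, s * x1) (r * y0, r * y1)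
      = s^2 * r^2 * gamma_form lam t (x0, x1) (y0, y1)" for s r x0 x1 y0 y1
    by (simp add: gamma_form_def power2_eq_square algebra_simps)
  have rep: "\<exists>s. s \<noteq> 0 \<and> (X, Y) = (s * fst (hcoord (point X Y)), s * snd (hcoord (point X Y)))"
    if "(X, Y) \<noteq> (0, 0)" for X Y
    using that by (cases "Y = 0") (auto simp: point_def)
  obtain s r where "s \<noteq> 0" "r \<noteq> 0"
    "(X, Y) = (s * fst (hcoord (point X Y)), s * snd (hcoord (point X Y)))"
    "(X', Y') = (r * fst (hcoord (point X' Y')), r * snd (hcoord (point X' Y')))"
    using rep[OF assms(1)] rep[OF assms(2)] by blast
  then show ?thesis
    using scale[of s "fst (hcoord (point X Y))" "snd (hcoord (point X Y))"
        r "fst (hcoord (point X' Y'))" "snd (hcoord (point X' Y'))"]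
    by (simp add: Gamma_def at_pt_def)
qed

lemma moebius_in_Aut_pair:
  assumes det: "a * d - b * c \<noteq> 0" "a' * d' - b' * c' \<noteq> 0"
    and semi: "\<And>x0 x1 y0 y1. gamma_form lam t (a * x0 + b * x1, c * x0 + d * x1)
      (a' * y0 + b' * y1, c' * y0 + d' * y1) = e * gamma_form lam t (x0, x1) (y0, y1)"
    and e: "e \<noteq> 0"
  shows "map_prod (moebius a b c d) (moebius a' b' c' d') \<in> carrier (Aut_pair (Gamma lam t))"
    (is "?f \<in> _")
proof -
  note nz = moebius_hcoord_nonzero
  have iff: "?f p \<in> Gamma lam t \<longleftrightarrow> p \<in> Gamma lam t" for p
    using point_in_Gamma[OF nz[OF det(1), of "fst p"] nz[OF det(2), of "snd p"], of lam t] semi e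
    by (simp add: moebius_def Gamma_def at_pt_def case_prod_unfold map_prod_def)
  have aut: "automorphism ?f"
    by (rule automorphism_moebius[OF det])
  then have "surj ?f"
    by (simp add: automorphism_def bij_def)
  moreover have "?f -` Gamma lam t = Gamma lam t"
    using iff by (simp add: vimage_def)
  ultimately have "?f ` Gamma lam t = Gamma lam t"
    by (metis surj_image_vimage_eq)
  then show ?thesis
    using aut by (simp add: Aut_pair_def)
qed

lemma phi_T_in_Aut_pair: "phi_T \<in> carrier (Aut_pair (Gamma lam t))"
proof -
  have "moebius 1 0 0 1 p = p" for p
    by (cases p) (auto simp: moebius_def point_def)
  then have reg: "regular_map fst" "regular_map snd"
    using moebius_regular[of 1 1 0 0] by (simp_all add: fun_eq_iff cong: if_cong)
  have inv: "inv_into UNIV phi_T = phi_T"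
    by (rule inv_equality) (auto simp: phi_T_def)
  have "bij phi_T"
    by (rule o_bij[of phi_T]) (auto simp: phi_T_def)
  moreover have "fst \<circ> phi_T = snd" "snd \<circ> phi_T = fst"
    by (auto simp: phi_T_def)
  ultimately have "automorphism phi_T"
    using inv reg by (simp add: automorphism_def morphism_def)
  moreover have "phi_T p \<in> Gamma lam t \<longleftrightarrow> p \<in> Gamma lam t" for p
    by (cases p) (auto simp: phi_T_def Gamma_def at_pt_def gamma_form_def algebra_simps
        split: prod.splits)
  then have "phi_T -` Gamma lam t = Gamma lam t"
    by (simp add: vimage_def)
  then have "phi_T ` Gamma lam t = Gamma lam t"
    using \<open>bij phi_T\<close> by (metis bij_is_surj surj_image_vimage_eq)
  ultimately show ?thesis
    by (simp add: Aut_pair_def)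
qed

lemma Z2_cubed_facts:
  assumes "group G" "G \<cong> Z2_cubed" "f \<in> carrier G" "g \<in> carrier G"
  shows "f \<otimes>\<^bsub>G\<^esub> g = g \<otimes>\<^bsub>G\<^esub> f" "f \<otimes>\<^bsub>G\<^esub> f = \<one>\<^bsub>G\<^esub>"
proof -
  interpret G: group G by fact
  obtain h where h: "h \<in> hom G Z2_cubed" "inj_on h (carrier G)"
    using assms(2) by (auto simp: is_iso_def iso_def bij_betw_def)
  have mult: "h (x \<otimes>\<^bsub>G\<^esub> y) = h x \<otimes>\<^bsub>Z2_cubed\<^esub> h y" "h x \<in> carrier Z2_cubed"
    if "x \<in> carrier G" "y \<in> carrier G" for x y
    using h(1) that by (auto simp: hom_def)
  have comm: "x \<otimes>\<^bsub>Z2_cubed\<^esub> y = y \<otimes>\<^bsub>Z2_cubed\<^esub> x" for x y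
    by (cases x; cases y) (simp add: Z2_cubed_def DirProd_def integer_mod_group_def add.commute)
  have sq: "x \<otimes>\<^bsub>Z2_cubed\<^esub> x = y \<otimes>\<^bsub>Z2_cubed\<^esub> y" for x y
    by (cases x; cases y) (simp add: Z2_cubed_def DirProd_def integer_mod_group_def)
  show "f \<otimes>\<^bsub>G\<^esub> g = g \<otimes>\<^bsub>G\<^esub> f"
    using inj_onD[OF h(2)] mult comm assms(3,4) by (metis G.m_closed)
  show "f \<otimes>\<^bsub>G\<^esub> f = \<one>\<^bsub>G\<^esub>"
    using inj_onD[OF h(2)] mult sq assms(3) by (metis G.m_closed G.one_closed G.l_one)
qed

text \<open>If \<open>t\<close> is fixed by an involution \<open>beta lam k\<close>, then \<open>(z, w) \<mapsto> (z, beta lam k w)\<close> preserves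
  \<open>Gamma lam t\<close> but does not commute with \<^const>\<open>phi_T\<close>.  In the remaining cases there is
  an automorphism with first component \<open>z \<mapsto> (lam - 1) z + 1\<close>, of order 3.\<close>

lemma exceptional_not_iso:
  assumes "distinct [0, 1, lam, t]" "exceptional lam t"
  shows "\<not> (group (Aut_pair (Gamma lam t)) \<and> Aut_pair (Gamma lam t) \<cong> Z2_cubed)"
proof
  let ?G = "Aut_pair (Gamma lam t)"
  assume *: "group ?G \<and> ?G \<cong> Z2_cubed"
  have A: False if "map_prod (moebius 1 0 0 1) (moebius a b 1 d) \<in> carrier ?G" (is "?f \<in> _")
    for a b d
  proof -
    have "?f \<circ> phi_T = phi_T \<circ> ?f"
      using Z2_cubed_facts(1)[of ?G ?f phi_T] * that phi_T_in_Aut_pair[of lam t]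
      by (simp add: Aut_pair_def)
    then have "(?f \<circ> phi_T) (Infty, Infty) = (phi_T \<circ> ?f) (Infty, Infty)"
      by simp
    then show False
      by (simp add: phi_T_def moebius_def point_def)
  qed
  have B: False if "map_prod (moebius (lam - 1) 1 0 1) (moebius a b c d) \<in> carrier ?G"
    (is "?f \<in> _") "lam^2 - lam + 1 = 0" for a b c d
  proof -
    have "?f \<circ> ?f = id"
      using Z2_cubed_facts(2)[of ?G ?f] * that(1) by (simp add: Aut_pair_def)
    then have "fst ((?f \<circ> ?f) (Aff 0, Infty)) = Aff 0"
      by simp
    then show False
      using assms(1) by (simp add: moebius_def point_def)
  qed
  have nz: "lam \<noteq> 0" "lam \<noteq> 1" "t \<noteq> 0" "t \<noteq> 1" "t \<noteq> lam"
    using assms(1) by auto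
  consider "t^2 = lam" | "(t - 1)^2 = 1 - lam" | "(t - lam)^2 = lam^2 - lam"
    | "lam^2 - lam + 1 = 0" "t * 3 = 1 + lam" | "lam^2 - lam + 1 = 0" "t = 1 + lam"
    | "lam^2 - lam + 1 = 0" "t = lam - 1" | "lam^2 - lam + 1 = 0" "t = 1 - lam"
    using assms(2) by (auto simp: exceptional_def)
  then show False
  proof cases
    case 1
    have "map_prod (moebius 1 0 0 1) (moebius 0 lam 1 0) \<in> carrier ?G"
      apply (rule moebius_in_Aut_pair[where e = "t^2"])
      subgoal using nz by simp
      subgoal using nz by simp
      subgoal by (simp add: 1[symmetric] gamma_form_def power2_eq_square algebra_simps)
      subgoal using nz by simp
      done
    then show False by (rule A)
  next
    case 2
    have "map_prod (moebius 1 0 0 1) (moebius 1 (- lam) 1 (- 1)) \<in> carrier ?G"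
      apply (rule moebius_in_Aut_pair[where e = "(1 - t)^2"])
      subgoal using nz by simp
      subgoal using nz by simp
      subgoal for x0 x1 y0 y1 using 2 unfolding gamma_form_def prod.case by algebra
      subgoal using nz by simp
      done
    then show False by (rule A)
  next
    case 3
    have det: "lam * - lam - - lam * 1 \<noteq> 0"
      using nz by (simp add: right_minus_eq)
    have "map_prod (moebius 1 0 0 1) (moebius lam (- lam) 1 (- lam)) \<in> carrier ?G"
      apply (rule moebius_in_Aut_pair[where e = "(lam - t)^2"])
      subgoal using nz by simp
      subgoal using nz det by simp
      subgoal for x0 x1 y0 y1 using 3 unfolding gamma_form_def prod.case by algebra
      subgoal using nz by simp
      done
    then show False by (rule A)
  next
    case 4
    have lam: "lam = 3 * t - 1" "3 * t^2 - 3 * t + 1 = 0"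
      using 4 by algebra+
    have "map_prod (moebius (lam - 1) 1 0 1) (moebius (lam - 1) 1 0 1) \<in> carrier ?G"
      apply (rule moebius_in_Aut_pair[where e = "lam - 1"])
      subgoal using nz by simp
      subgoal using nz by simp
      subgoal for x0 x1 y0 y1 using lam unfolding gamma_form_def prod.case by algebra
      subgoal using nz by simp
      done
    then show False using 4(1) by (rule B)
  next
    case 5
    have "map_prod (moebius (lam - 1) 1 0 1) (moebius lam 0 1 (- 1)) \<in> carrier ?G"
      apply (rule moebius_in_Aut_pair[where e = "- lam"])
      subgoal using nz by simp
      subgoal using nz by simp
      subgoal for x0 x1 y0 y1 using 5 unfolding gamma_form_def prod.case by algebra
      subgoal using nz by simp
      done
    then show False using 5(1) by (rule B)
  next
    case 6
    have "map_prod (moebius (lam - 1) 1 0 1) (moebius 0 lam (lam - 1) 1) \<in> carrier ?G"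
      apply (rule moebius_in_Aut_pair[where e = 1])
      subgoal using nz by simp
      subgoal using nz by simp
      subgoal for x0 x1 y0 y1 using 6 unfolding gamma_form_def prod.case by algebra
      subgoal using nz by simp
      done
    then show False using 6(1) by (rule B)
  next
    case 7
    have "map_prod (moebius (lam - 1) 1 0 1) (moebius 1 (- 1) 1 0) \<in> carrier ?G"
      apply (rule moebius_in_Aut_pair[where e = 1])
      subgoal using nz by simp
      subgoal using nz by simp
      subgoal for x0 x1 y0 y1 using 7 unfolding gamma_form_def prod.case by algebra
      subgoal using nz by simp
      done
    then show False using 7(1) by (rule B)
  qed
qed

end

theory Submission
  imports Defs "Jordan_Normal_Form.Determinant" "HOL-Computational_Algebra.Field_as_Ring"
    "HOL-Computational_Algebra.Fundamental_Theorem_Algebra"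
begin

text \<open>The argument has an algebraic half, which determines all automorphisms of \<open>P\<^sup>1 \<times> P\<^sup>1\<close>, and a
  geometric half, which singles out those that preserve the curve.

  A regular map \<open>P\<^sup>1 \<times> P\<^sup>1 \<rightarrow> P\<^sup>1\<close> is given locally by pairs of biforms.  Since the ring of polynomials
  in two variables is factorial, a local pair can be divided by its greatest common divisor, and the
  reduced pair represents the map everywhere without common zeros (\<open>regular_map_global\<close>).  But two
  biforms of bidegree \<open>(a, b)\<close> with \<open>a, b > 0\<close> always have a common zero: their intersection number
  is \<open>2ab\<close>, and the resultant with respect to the first factor makes this visible
  (\<open>biforms_common_zero\<close>).  So a regular map depends on one coordinate only.  For a bijective morphism
  the two components depend on different coordinates and are bijective on \<open>P\<^sup>1\<close>, which forces their
  degree to be 1.  Hence automorphisms are pairs of Moebius maps, possibly composed with the swap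
  \<^const>\<open>phi_T\<close> (\<open>automorphism_iff\<close>).

  The discriminant of the equation of \<open>Gamma\<close> with respect to either variable is
  \<open>16 t (t - 1) (t - lam) \<cdot> x (x - 1) (x - lam)\<close>, so both projections branch exactly over
  \<open>0, 1, lam, \<infinity>\<close>, and the unique point over a branch point \<open>k\<close> has second coordinate
  \<open>beta lam k t\<close>.  If a pair \<open>(m, n)\<close> of Moebius maps preserves \<open>Gamma\<close>, then \<open>m\<close> and \<open>n\<close> permute the
  branch points and \<open>n\<close> sends \<open>beta lam k t\<close> to \<open>beta lam (m k) t\<close>.  The maps \<open>beta lam k\<close> form a
  Klein four-group that is simply transitive on the branch points; composing with some
  \<open>sigma lam k\<close> one may therefore assume that \<open>m\<close> fixes \<open>\<infinity>\<close>, so that \<open>m\<close> is affine.  Writing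
  \<open>n = n\<^sub>0 \<circ> beta lam p\<close> with \<open>n\<^sub>0\<close> affine, and using that affine maps permuting \<open>0, 1, lam\<close> conjugate the
  involutions \<open>beta lam k\<close> among each other, one gets \<open>n\<^sub>0 = m\<close> as soon as the four points
  \<open>beta lam k t\<close> are distinct, and then \<open>m (beta lam p t) = t\<close>.  Going through the at most six affine
  permutations, this last equation has no solution other than \<open>m = id\<close>, \<open>p = \<infinity>\<close>, unless \<open>(lam, t)\<close> is
  exceptional (\<open>normalised_symmetry_trivial\<close>).  So the group consists of the eight elements
  \<open>sigma lam k\<close> and \<open>sigma lam k \<circ> phi_T\<close>, which are products of three commuting involutions.\<close>

section \<open>Biforms as polynomials in two variables\<close>

text \<open>The outer variable of a \<open>complex poly poly\<close> is the affine coordinate on the first factor, the inner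
  one that on the second factor.\<close>

definition eval2 :: "complex poly poly \<Rightarrow> complex \<Rightarrow> complex \<Rightarrow> complex" where
  "eval2 P x y = poly (poly P [:x:]) y"

definition bidegree_le :: "complex poly poly \<Rightarrow> nat \<Rightarrow> nat \<Rightarrow> bool" where
  "bidegree_le P a b \<longleftrightarrow> degree P \<le> a \<and> (\<forall>i. degree (coeff P i) \<le> b)"

definition homogenise :: "nat \<Rightarrow> nat \<Rightarrow> complex poly poly \<Rightarrow> biform" where
  "homogenise a b P = (\<lambda>(x0, x1) (y0, y1).
     \<Sum>i\<le>a. \<Sum>j\<le>b. coeff (coeff P i) j * (x0 ^ i * x1 ^ (a - i)) * (y0 ^ j * y1 ^ (b - j)))"

lemma eval2_simps [simp]:
  "eval2 (P * Q) x y = eval2 P x y * eval2 Q x y"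
  "eval2 (P - Q) x y = eval2 P x y - eval2 Q x y"
  by (simp_all add: eval2_def)

lemma eval2_eq_0_imp:
  assumes "\<And>x y. eval2 P x y = 0"
  shows "P = 0"
proof (rule ccontr)
  assume "P \<noteq> 0"
  then have "finite {r. poly P r = 0}"
    by (rule poly_roots_finite)
  moreover have "range (\<lambda>x. [:x:]) \<subseteq> {r. poly P r = 0}"
    using assms by (auto simp: eval2_def poly_all_0_iff_0[symmetric])
  moreover have "infinite (range (\<lambda>x::complex. [:x:]))"
    using infinite_UNIV_char_0[where 'a = complex] by (subst finite_image_iff) (auto simp: inj_def)
  ultimately show False
    using finite_subset by blast
qed

lemma biforms_eq_homogenise:
  "F \<in> biforms a b \<longleftrightarrow> (\<exists>P. bidegree_le P a b \<and> F = homogenise a b P)"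
proof
  assume "F \<in> biforms a b"
  then obtain c where c: "\<And>x0 x1 y0 y1. F (x0, x1) (y0, y1) =
     (\<Sum>i\<le>a. \<Sum>j\<le>b. c i j * (x0 ^ i * x1 ^ (a - i)) * (y0 ^ j * y1 ^ (b - j)))"
    unfolding biforms_def by blast
  define P where "P = (\<Sum>i\<le>a. monom (\<Sum>j\<le>b. monom (c i j) j) i)"
  have co: "coeff P i = (if i \<le> a then \<Sum>j\<le>b. monom (c i j) j else 0)" for i
    by (simp add: P_def coeff_sum)
  have co2: "coeff (coeff P i) j = (if i \<le> a \<and> j \<le> b then c i j else 0)" for i j
    by (simp add: co coeff_sum)
  have "bidegree_le P a b"
    by (auto simp: bidegree_le_def co2 co intro!: degree_le) (simp add: coeff_sum)
  moreover have "F = homogenise a b P"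
    by (auto simp: fun_eq_iff homogenise_def c co2)
  ultimately show "\<exists>P. bidegree_le P a b \<and> F = homogenise a b P"
    by blast
next
  assume "\<exists>P. bidegree_le P a b \<and> F = homogenise a b P"
  then show "F \<in> biforms a b"
    unfolding biforms_def homogenise_def by auto
qed

lemma poly_eq_sum_le:
  fixes p :: "'a::comm_semiring_1 poly"
  assumes "degree p \<le> n"
  shows "poly p x = (\<Sum>i\<le>n. coeff p i * x ^ i)"
  unfolding poly_altdef using assms
  by (intro sum.mono_neutral_left) (auto simp: coeff_eq_0)

lemma homogenise_affine:
  assumes "bidegree_le P a b" "x1 \<noteq> 0" "y1 \<noteq> 0"
  shows "homogenise a b P (x0, x1) (y0, y1) = x1 ^ a * y1 ^ b * eval2 P (x0 / x1) (y0 / y1)"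
proof -
  have pw: "u ^ k * v ^ (n - k) = v ^ n * (u / v) ^ k" if "k \<le> n" "v \<noteq> 0" for u v :: complex and k n
    using that by (simp add: power_diff power_divide)
  have "poly P [:x0 / x1:] = (\<Sum>i\<le>a. coeff P i * [:x0 / x1:] ^ i)"
    using assms(1) by (intro poly_eq_sum_le) (auto simp: bidegree_le_def)
  then have "eval2 P (x0 / x1) (y0 / y1) = (\<Sum>i\<le>a. poly (coeff P i) (y0 / y1) * (x0 / x1) ^ i)"
    by (simp add: eval2_def poly_sum)
  also have "\<dots> = (\<Sum>i\<le>a. \<Sum>j\<le>b. coeff (coeff P i) j * (y0 / y1) ^ j * (x0 / x1) ^ i)"
    using assms(1) by (intro sum.cong refl)
      (simp add: poly_eq_sum_le[where n = b] bidegree_le_def sum_distrib_right)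
  finally have ev: "eval2 P (x0 / x1) (y0 / y1) = \<dots>" .
  show ?thesis
    unfolding homogenise_def prod.case ev sum_distrib_left
    by (intro sum.cong refl) (simp add: pw[OF _ assms(2)] pw[OF _ assms(3)])
qed

text \<open>Identities between biforms are checked where all denominators are nonzero; this extends them to
  the points at infinity.\<close>

lemma continuous_eq_at_0:
  fixes f g :: "complex \<Rightarrow> complex"
  assumes "isCont f 0" "isCont g 0" "\<And>x. x \<noteq> 0 \<Longrightarrow> f x = g x"
  shows "f 0 = g 0"
proof -
  have "f \<midarrow>0\<rightarrow> g 0"
    using assms(2,3) by (simp add: isCont_def cong: LIM_cong)
  then show ?thesis
    using assms(1) LIM_unique by (auto simp: isCont_def)
qed

lemma isCont_homogenise:
  "isCont (\<lambda>u. homogenise a b P (x0, u) (y0, y1)) u"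
  "isCont (\<lambda>u. homogenise a b P (x0, x1) (y0, u)) u"
  by (auto simp: homogenise_def)

lemma homogenise_mult:
  assumes "bidegree_le P a b" "bidegree_le Q c d" "bidegree_le (P * Q) (a + c) (b + d)"
  shows "homogenise (a + c) (b + d) (P * Q) x y = homogenise a b P x y * homogenise c d Q x y"
proof -
  have *: "homogenise (a + c) (b + d) (P * Q) (x0, x1) (y0, y1) =
      homogenise a b P (x0, x1) (y0, y1) * homogenise c d Q (x0, x1) (y0, y1)"
    if "x1 \<noteq> 0" "y1 \<noteq> 0" for x0 x1 y0 y1
    using assms that by (simp add: homogenise_affine power_add)
  have **: "homogenise (a + c) (b + d) (P * Q) (x0, x1) (y0, y1) =
      homogenise a b P (x0, x1) (y0, y1) * homogenise c d Q (x0, x1) (y0, y1)"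
    if "x1 \<noteq> 0" for x0 x1 y0 y1
  proof (cases "y1 = 0")
    case True
    show ?thesis
      unfolding True
      by (rule continuous_eq_at_0[where f = "\<lambda>u. homogenise (a + c) (b + d) (P * Q) (x0, x1) (y0, u)"
         and g = "\<lambda>u. homogenise a b P (x0, x1) (y0, u) * homogenise c d Q (x0, x1) (y0, u)"])
        (use * that in \<open>auto intro!: isCont_homogenise continuous_intros\<close>)
  qed (use * that in auto)
  have "homogenise (a + c) (b + d) (P * Q) (x0, x1) (y0, y1) =
      homogenise a b P (x0, x1) (y0, y1) * homogenise c d Q (x0, x1) (y0, y1)" for x0 x1 y0 y1
  proof (cases "x1 = 0")
    case True
    show ?thesis
      unfolding True
      by (rule continuous_eq_at_0[where f = "\<lambda>u. homogenise (a + c) (b + d) (P * Q) (x0, u) (y0, y1)"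
         and g = "\<lambda>u. homogenise a b P (x0, u) (y0, y1) * homogenise c d Q (x0, u) (y0, y1)"])
        (use ** in \<open>auto intro!: isCont_homogenise continuous_intros\<close>)
  qed (use ** in auto)
  then show ?thesis
    by (cases x; cases y) simp
qed

text \<open>The degree in the inner variable.\<close>

definition ydegree :: "complex poly poly \<Rightarrow> nat" where
  "ydegree P = Max ((\<lambda>i. degree (coeff P i)) ` {..degree P})"

lemma degree_coeff_le_ydegree: "degree (coeff P i) \<le> ydegree P"
  by (cases "i \<le> degree P") (auto simp: ydegree_def coeff_eq_0 intro: Max_ge)

lemma ydegree_attained:
  assumes "P \<noteq> 0"
  shows "\<exists>i. coeff (coeff P i) (ydegree P) \<noteq> 0"
proof (cases "ydegree P = 0")
  case True
  then have "degree (lead_coeff P) = 0"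
    using degree_coeff_le_ydegree[of P "degree P"] by simp
  then show ?thesis
    using assms True by (metis leading_coeff_0_iff)
next
  case False
  have "ydegree P \<in> (\<lambda>i. degree (coeff P i)) ` {..degree P}"
    unfolding ydegree_def by (rule Max_in) auto
  then obtain i where "ydegree P = degree (coeff P i)"
    by blast
  with False show ?thesis
    by (metis degree_0 leading_coeff_0_iff)
qed

lemma bidegree_le_iff: "bidegree_le P a b \<longleftrightarrow> degree P \<le> a \<and> ydegree P \<le> b"
proof -
  have "(\<forall>i. degree (coeff P i) \<le> b) \<longleftrightarrow> ydegree P \<le> b"
  proof
    assume "\<forall>i. degree (coeff P i) \<le> b"
    then show "ydegree P \<le> b" by (simp add: ydegree_def)
  next
    assume "ydegree P \<le> b"
    then show "\<forall>i. degree (coeff P i) \<le> b"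
      using degree_coeff_le_ydegree[of P] order.trans by blast
  qed
  then show ?thesis by (simp add: bidegree_le_def)
qed

lemma coeff_mult_at_degree_bounds:
  assumes "degree p \<le> m" "degree q \<le> n"
  shows "coeff (p * q) (m + n) = coeff p m * coeff q n"
proof -
  have "coeff p i * coeff q (m + n - i) = 0" if "i \<noteq> m" "i \<le> m + n" for i
  proof (cases "i < m")
    case True
    then have "n < m + n - i" by simp
    then show ?thesis using assms(2) by (simp add: coeff_eq_0)
  next
    case False
    then show ?thesis using assms(1) that by (simp add: coeff_eq_0)
  qed
  then have "coeff (p * q) (m + n) = (\<Sum>i\<in>{m}. coeff p i * coeff q (m + n - i))"
    unfolding coeff_mult by (intro sum.mono_neutral_right) auto
  then show ?thesis by simp
qed

text \<open>The polynomials in the outer variable formed by the coefficients of highest inner degree multiply,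
  and they are nonzero.  This is what controls the behaviour of a factorisation along the line at
  infinity of the second factor; along the other one the same is done by \<open>degree_mult_eq\<close>.\<close>

lemma ydegree_mult_ge:
  assumes "P \<noteq> 0" "Q \<noteq> 0"
  shows "ydegree P + ydegree Q \<le> ydegree (P * Q)"
proof -
  define top where "top d R = map_poly (\<lambda>c. coeff c d) R" for d and R :: "complex poly poly"
  have coeff_top: "coeff (top d R) i = coeff (coeff R i) d" for d R i
    by (simp add: top_def coeff_map_poly)
  have "top (ydegree P + ydegree Q) (P * Q) = top (ydegree P) P * top (ydegree Q) Q"
    by (rule poly_eqI) (simp add: coeff_top coeff_mult[of P] coeff_mult[of "top _ _"] coeff_sum
        coeff_mult_at_degree_bounds[OF degree_coeff_le_ydegree degree_coeff_le_ydegree])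
  moreover have "top (ydegree P) P \<noteq> 0" "top (ydegree Q) Q \<noteq> 0"
    using ydegree_attained[OF assms(1)] ydegree_attained[OF assms(2)]
    by (auto simp: poly_eq_iff coeff_top)
  ultimately have "top (ydegree P + ydegree Q) (P * Q) \<noteq> 0"
    by simp
  then obtain i where "coeff (coeff (P * Q) i) (ydegree P + ydegree Q) \<noteq> 0"
    by (auto simp: poly_eq_iff coeff_top)
  then have "ydegree P + ydegree Q \<le> degree (coeff (P * Q) i)"
    by (rule le_degree)
  then show ?thesis
    using degree_coeff_le_ydegree order.trans by blast
qed

section \<open>Regular maps are globally given by two biforms\<close>

lemma point_scale: "k \<noteq> 0 \<Longrightarrow> point (k * u) (k * v) = point u v"
  by (simp add: point_def)

lemma point_eq_iff:
  assumes "(X, Y) \<noteq> (0, 0)" "(X', Y') \<noteq> (0, 0)"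
  shows "point X Y = point X' Y' \<longleftrightarrow> X * Y' = X' * Y"
  using assms by (auto simp: point_def field_simps)

lemma at_pt_homogenise_affine:
  assumes "bidegree_le P a b"
  shows "at_pt (homogenise a b P) (Aff x, Aff y) = eval2 P x y"
  using homogenise_affine[OF assms, of 1 1 x y] by (simp add: at_pt_def)

lemma regular_map_local:
  assumes "regular_map f"
  obtains a b P Q R where "bidegree_le P a b" "bidegree_le Q a b" "R \<noteq> 0"
    "(at_pt (homogenise a b P) p, at_pt (homogenise a b Q) p) \<noteq> (0, 0)"
    "f p = point (at_pt (homogenise a b P) p) (at_pt (homogenise a b Q) p)"
    "\<And>x y. eval2 R x y \<noteq> 0 \<Longrightarrow> (eval2 P x y, eval2 Q x y) \<noteq> (0, 0) \<and>
      f (Aff x, Aff y) = point (eval2 P x y) (eval2 Q x y)"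
proof -
  obtain a b c d F G H where *: "F \<in> biforms a b" "G \<in> biforms a b" "H \<in> biforms c d"
    "at_pt H p \<noteq> 0" "\<And>q. at_pt H q \<noteq> 0 \<Longrightarrow>
        (at_pt F q, at_pt G q) \<noteq> (0, 0) \<and> f q = point (at_pt F q) (at_pt G q)"
    using assms unfolding regular_map_def by metis
  obtain P Q R where poly: "bidegree_le P a b" "F = homogenise a b P" 
    "bidegree_le Q a b" "G = homogenise a b Q" "bidegree_le R c d" "H = homogenise c d R"
    using *(1-3) unfolding biforms_eq_homogenise by blast
  have "R \<noteq> 0"
    using *(4) poly(6) by (auto simp: at_pt_def homogenise_def split: prod.splits)
  show ?thesis
    by (rule that[OF poly(1) poly(3) \<open>R \<noteq> 0\<close>])
      (use *(5)[of p] *(4,5) poly in \<open>auto simp: at_pt_homogenise_affine[symmetric]\<close>)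
qed

text \<open>The reduced pair \<open>(P, Q)\<close> obtained from one local representation serves everywhere: any other local
  pair satisfies \<open>P2 * Q = P * Q2\<close>, so by coprimality it is \<open>(K * P, K * Q)\<close>.  A common zero of
  \<open>(P, Q)\<close> would be a common zero of \<open>(P2, Q2)\<close>.  The bidegree of \<open>(P, Q)\<close> has to be chosen
  minimal for this to include the points at infinity, since otherwise both forms would vanish there.\<close>

theorem regular_map_global:
  assumes "regular_map f"
  obtains a b F G where "F \<in> biforms a b" "G \<in> biforms a b"
    "\<And>p. (at_pt F p, at_pt G p) \<noteq> (0, 0)" "\<And>p. f p = point (at_pt F p) (at_pt G p)"
proof -
  obtain a1 b1 P1 Q1 R1 where 1: "bidegree_le P1 a1 b1" "bidegree_le Q1 a1 b1" "R1 \<noteq> 0"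
    "(at_pt (homogenise a1 b1 P1) (Infty, Infty), at_pt (homogenise a1 b1 Q1) (Infty, Infty)) \<noteq> (0, 0)"
    "\<And>x y. eval2 R1 x y \<noteq> 0 \<Longrightarrow> (eval2 P1 x y, eval2 Q1 x y) \<noteq> (0, 0) \<and>
      f (Aff x, Aff y) = point (eval2 P1 x y) (eval2 Q1 x y)"
    by (rule regular_map_local[OF assms, of "(Infty, Infty)"]) blast
  define D where "D = gcd P1 Q1"
  have "P1 \<noteq> 0 \<or> Q1 \<noteq> 0"
    using 1(4) by (auto simp: at_pt_def homogenise_def)
  then have D0: "D \<noteq> 0"
    by (simp add: D_def)
  obtain P Q where PQ: "P1 = P * D" "Q1 = Q * D" "coprime P Q"
    using gcd_coprime_exists[of P1 Q1] D0 unfolding D_def by blast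
  define a where "a = max (degree P) (degree Q)"
  define b where "b = max (ydegree P) (ydegree Q)"
  have le: "bidegree_le P a b" "bidegree_le Q a b"
    by (auto simp: bidegree_le_iff a_def b_def)
  have main: "(at_pt (homogenise a b P) p, at_pt (homogenise a b Q) p) \<noteq> (0, 0) \<and>
     f p = point (at_pt (homogenise a b P) p) (at_pt (homogenise a b Q) p)" for p
  proof -
    obtain a2 b2 P2 Q2 R2 where 2: "bidegree_le P2 a2 b2" "bidegree_le Q2 a2 b2" "R2 \<noteq> 0"
      "(at_pt (homogenise a2 b2 P2) p, at_pt (homogenise a2 b2 Q2) p) \<noteq> (0, 0)"
      "f p = point (at_pt (homogenise a2 b2 P2) p) (at_pt (homogenise a2 b2 Q2) p)"
      "\<And>x y. eval2 R2 x y \<noteq> 0 \<Longrightarrow> (eval2 P2 x y, eval2 Q2 x y) \<noteq> (0, 0) \<and>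
        f (Aff x, Aff y) = point (eval2 P2 x y) (eval2 Q2 x y)"
      by (rule regular_map_local[OF assms, of p]) blast
    \<comment> \<open>The two representations agree on the intersection of two nonempty open sets, which is dense.\<close>
    have "R1 * R2 * (P1 * Q2 - P2 * Q1) = 0"
    proof (rule eval2_eq_0_imp)
      fix x y
      show "eval2 (R1 * R2 * (P1 * Q2 - P2 * Q1)) x y = 0"
      proof (cases "eval2 R1 x y = 0 \<or> eval2 R2 x y = 0")
        case False
        then have "point (eval2 P1 x y) (eval2 Q1 x y) = point (eval2 P2 x y) (eval2 Q2 x y)"
          "(eval2 P1 x y, eval2 Q1 x y) \<noteq> (0, 0)" "(eval2 P2 x y, eval2 Q2 x y) \<noteq> (0, 0)"
          using 1(5)[of x y] 2(6)[of x y] by simp_all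
        then show ?thesis
          by (subst (asm) point_eq_iff) simp_all
      qed auto
    qed
    then have "P1 * Q2 = P2 * Q1"
      using 1(3) 2(3) by simp
    then have "D * (P * Q2) = D * (P2 * Q)"
      by (simp only: PQ mult_ac)
    then have cross: "P * Q2 = P2 * Q"
      using D0 by simp
    then have "P dvd P2 * Q" "Q dvd P * Q2"
      by (metis dvd_triv_left, metis dvd_triv_right)
    then have "P dvd P2" "Q dvd Q2"
      using PQ(3) coprime_dvd_mult_left_iff[OF PQ(3), of P2] 
       coprime_dvd_mult_right_iff[of Q P Q2] by (simp_all add: coprime_commute)
    then obtain K1 K2 where K12: "P2 = P * K1" "Q2 = Q * K2"
      by (auto elim!: dvdE)
    have "\<exists>K. P2 = K * P \<and> Q2 = K * Q"
    proof (cases "P = 0")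
      case True
      then show ?thesis using K12 by (auto simp: mult.commute)
    next
      case False
      then show ?thesis using cross K12 by (intro exI[of _ K1]) (simp add: mult_ac)
    qed
    then obtain K where K: "P2 = K * P" "Q2 = K * Q"
      by blast
    have "P2 \<noteq> 0 \<or> Q2 \<noteq> 0"
      using 2(4) by (auto simp: at_pt_def homogenise_def split: prod.splits)
    then have K0: "K \<noteq> 0" and PQ0: "P \<noteq> 0 \<or> Q \<noteq> 0"
      using K by auto
    have a2: "degree K + a \<le> a2"
    proof -
      have "degree K + degree P \<le> a2" if "P \<noteq> 0"
        using 2(1) K K0 that by (simp add: bidegree_le_def degree_mult_eq)
      moreover have "degree K + degree Q \<le> a2" if "Q \<noteq> 0"
        using 2(2) K K0 that by (simp add: bidegree_le_def degree_mult_eq)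
      ultimately show ?thesis
        using PQ0 by (cases "P = 0"; cases "Q = 0") (auto simp: a_def)
    qed
    have b2: "ydegree K + b \<le> b2"
    proof -
      have "ydegree K + ydegree P \<le> b2" if "P \<noteq> 0"
        using 2(1) K ydegree_mult_ge[OF K0 that] by (simp add: bidegree_le_iff)
      moreover have "ydegree K + ydegree Q \<le> b2" if "Q \<noteq> 0"
        using 2(2) K ydegree_mult_ge[OF K0 that] by (simp add: bidegree_le_iff)
      moreover have "ydegree 0 = 0"
        by (simp add: ydegree_def)
      ultimately show ?thesis
        using PQ0 by (cases "P = 0"; cases "Q = 0") (auto simp: b_def)
    qed
    define k where "k = at_pt (homogenise (a2 - a) (b2 - b) K) p"
    have leK: "bidegree_le K (a2 - a) (b2 - b)" and sub: "a2 - a + a = a2" "b2 - b + b = b2"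
      using a2 b2 by (auto simp: bidegree_le_iff)
    have "at_pt (homogenise a2 b2 P2) p = k * at_pt (homogenise a b P) p"
      using homogenise_mult[OF leK le(1)] 2(1) by (simp add: at_pt_def k_def sub K)
    moreover have "at_pt (homogenise a2 b2 Q2) p = k * at_pt (homogenise a b Q) p"
      using homogenise_mult[OF leK le(2)] 2(2) by (simp add: at_pt_def k_def sub K)
    ultimately show ?thesis
      using 2(4,5) by (cases "k = 0") (simp_all add: point_scale)
  qed
  have "homogenise a b P \<in> biforms a b" "homogenise a b Q \<in> biforms a b"
    using le by (auto simp: biforms_eq_homogenise)
  then show ?thesis
    using main by (intro that) auto
qed

section \<open>Biforms of positive bidegree have a common zero\<close>

text \<open>The form of degree \<open>a\<close> in two homogeneous variables with dehomogenisation \<open>p\<close>.\<close>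

definition form1 :: "nat \<Rightarrow> complex poly \<Rightarrow> complex \<times> complex \<Rightarrow> complex" where
  "form1 a p = (\<lambda>(x0, x1). \<Sum>i\<le>a. coeff p i * (x0 ^ i * x1 ^ (a - i)))"

lemma biform_slice:
  assumes "F \<in> biforms a b"
  shows "\<exists>p. degree p \<le> a \<and> (\<forall>x. F x y = form1 a p x)"
proof -
  obtain c where c: "\<And>x0 x1 y0 y1. F (x0, x1) (y0, y1) =
     (\<Sum>i\<le>a. \<Sum>j\<le>b. c i j * (x0 ^ i * x1 ^ (a - i)) * (y0 ^ j * y1 ^ (b - j)))"
    using assms unfolding biforms_def by blast
  define p where "p = (\<Sum>i\<le>a. monom (\<Sum>j\<le>b. c i j * (fst y ^ j * snd y ^ (b - j))) i)"
  have co: "coeff p i = (if i \<le> a then \<Sum>j\<le>b. c i j * (fst y ^ j * snd y ^ (b - j)) else 0)" for i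
    by (simp add: p_def coeff_sum)
  have "degree p \<le> a"
    by (rule degree_le) (simp add: co)
  moreover have "F x y = form1 a p x" for x
    by (cases x; cases y) (simp add: form1_def c co sum_distrib_left sum_distrib_right mult_ac)
  ultimately show ?thesis by blast
qed

lemma form1_affine:
  assumes "degree p \<le> a" "x1 \<noteq> 0"
  shows "form1 a p (x0, x1) = x1 ^ a * poly p (x0 / x1)"
proof -
  have "x0 ^ i * x1 ^ (a - i) = x1 ^ a * (x0 / x1) ^ i" if "i \<le> a" for i
    using that assms(2) by (simp add: power_diff power_divide)
  then show ?thesis
    unfolding form1_def poly_eq_sum_le[OF assms(1)] prod.case sum_distrib_left
    by (intro sum.cong refl) simp
qed

lemma form1_infinity: "form1 a p (x0, 0) = coeff p a * x0 ^ a"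
proof -
  have "form1 a p (x0, 0) = (\<Sum>i\<in>{a}. coeff p i * (x0 ^ i * 0 ^ (a - i)))"
    unfolding form1_def prod.case by (rule sum.mono_neutral_right) auto
  then show ?thesis by simp
qed

text \<open>Forms without common zero on \<open>P\<^sup>1\<close> are coprime, and one of them, say \<open>p\<close>, has full degree \<open>a\<close>.
  Then \<open>p\<close> divides \<open>v\<close>, which is possible only for \<open>v = 0\<close>.  The conditions in \<open>no_root\<close> say that there
  is no common zero in the affine part and at infinity.\<close>

lemma no_syzygy_below_degree:
  fixes p q u v :: "complex poly"
  assumes deg: "degree p \<le> a" "degree q \<le> a" "degree u < a" "degree v < a"
    and no_root: "\<And>x. poly p x \<noteq> 0 \<or> poly q x \<noteq> 0" "coeff p a \<noteq> 0 \<or> coeff q a \<noteq> 0"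
    and syz: "u * p + v * q = 0"
  shows "u = 0 \<and> v = 0"
proof -
  have cop: "coprime p q"
  proof (rule coprimeI)
    fix d assume d: "d dvd p" "d dvd q"
    have "d \<noteq> 0"
      using d no_root(1)[of 0] by auto
    moreover have "degree d = 0"
    proof (rule ccontr)
      assume "degree d \<noteq> 0"
      then have "\<not> constant (poly d)"
        by (simp add: constant_degree)
      then obtain x where "poly d x = 0"
        using fundamental_theorem_of_algebra by blast
      then show False
        using d no_root(1)[of x] by (auto elim!: dvdE)
    qed
    ultimately show "is_unit d"
      by (simp add: is_unit_iff_degree)
  qed
  have main: "u = 0 \<and> v = 0"
    if h: "coprime p q" "degree p = a" "p \<noteq> 0" "degree v < a" "u * p + v * q = 0"
    for p q u v :: "complex poly"
  proof -
    have "v * q = p * (- u)"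
      using h(5) by (simp add: add_eq_0_iff mult.commute)
    then have "p dvd v"
      using coprime_dvd_mult_left_iff[OF h(1), of v] by simp
    then have "v = 0"
      using h(2,4) dvd_imp_degree_le[of p v] by (cases "v = 0") auto
    then show ?thesis
      using h(3,5) by simp
  qed
  from no_root(2) show ?thesis
  proof
    assume "coeff p a \<noteq> 0"
    then show ?thesis
      using main[OF cop _ _ deg(4) syz] deg(1) le_degree[of p a] by fastforce
  next
    assume "coeff q a \<noteq> 0"
    then show ?thesis
      using main[of q p u v] cop deg syz le_degree[of q a]
      by (fastforce simp: add.commute coprime_commute)
  qed
qed

text \<open>The matrix of the linear map that sends the coefficients of two polynomials \<open>u, v\<close> of degree less
  than \<open>a\<close> to the values of \<open>u F + v G\<close> at the \<open>2a\<close> points \<open>0, \<dots>, 2a - 1\<close>, for a fixed second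
  coordinate \<open>y\<close>.  As \<open>u F + v G\<close> has degree less than \<open>2a\<close>, this is the Sylvester matrix up to an
  invertible Vandermonde factor; taking values instead of coefficients avoids convolutions.\<close>

definition syzygy_matrix :: "nat \<Rightarrow> biform \<Rightarrow> biform \<Rightarrow> complex \<times> complex \<Rightarrow> complex mat" where
  "syzygy_matrix a F G y = mat (2 * a) (2 * a) (\<lambda>(s, r).
     if r < a then of_nat s ^ r * F (of_nat s, 1) y else of_nat s ^ (r - a) * G (of_nat s, 1) y)"

lemma syzygy_matrix_nonsingular:
  assumes FG: "F \<in> biforms a b" "G \<in> biforms a b" and "0 < a"
    and no_zero: "\<And>x. x \<noteq> (0, 0) \<Longrightarrow> (F x y, G x y) \<noteq> (0, 0)"
  shows "det (syzygy_matrix a F G y) \<noteq> 0"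
proof
  let ?M = "syzygy_matrix a F G y"
  have M: "?M \<in> carrier_mat (2 * a) (2 * a)"
    by (simp add: syzygy_matrix_def)
  assume "det ?M = 0"
  then obtain c where c: "c \<in> carrier_vec (2 * a)" "c \<noteq> 0\<^sub>v (2 * a)" "?M *\<^sub>v c = 0\<^sub>v (2 * a)"
    using det_0_iff_vec_prod_zero[OF M] by blast
  obtain p q where p: "degree p \<le> a" "\<And>x. F x y = form1 a p x"
    and q: "degree q \<le> a" "\<And>x. G x y = form1 a q x"
    using FG[THEN biform_slice] by metis
  define u where "u = (\<Sum>r<a. monom (c $ r) r)"
  define v where "v = (\<Sum>r<a. monom (c $ (a + r)) r)"
  have split: "(\<Sum>r<m + n. f r) = (\<Sum>r<m. f r) + (\<Sum>r<n. f (m + r))" for m n and f :: "nat \<Rightarrow> complex"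
    by (induction n) (simp_all add: add.assoc)
  have deg: "degree u < a" "degree v < a"
    unfolding u_def v_def using \<open>0 < a\<close>
    by (auto intro!: degree_sum_less order.strict_trans1[OF degree_monom_le])
  have "poly (u * p + v * q) x = poly 0 x" if x: "x \<in> of_nat ` {..<2 * a}" for x
  proof -
    obtain s where s: "s < 2 * a" "x = of_nat s" using x by blast
    have Fs: "F (of_nat s, 1) y = poly p x" "G (of_nat s, 1) y = poly q x"
      using form1_affine[OF p(1), of 1 x] form1_affine[OF q(1), of 1 x] p(2) q(2) s by simp_all
    have "0 = (?M *\<^sub>v c) $ s"
      using c(3) s by simp
    also have "\<dots> = (\<Sum>r<2 * a. ?M $$ (s, r) * c $ r)"
      using s c(1) by (simp add: syzygy_matrix_def scalar_prod_def atLeast0LessThan)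
    also have "\<dots> = (\<Sum>r<a. ?M $$ (s, r) * c $ r) + (\<Sum>r<a. ?M $$ (s, a + r) * c $ (a + r))"
      unfolding mult_2 by (rule split)
    also have "(\<Sum>r<a. ?M $$ (s, r) * c $ r) = poly u x * poly p x"
      using s by (simp add: syzygy_matrix_def Fs u_def poly_sum poly_monom sum_distrib_right sum_distrib_left mult_ac)
    also have "(\<Sum>r<a. ?M $$ (s, a + r) * c $ (a + r)) = poly v x * poly q x"
      using s by (simp add: syzygy_matrix_def Fs v_def poly_sum poly_monom sum_distrib_right sum_distrib_left mult_ac)
    finally show ?thesis by simp
  qed
  moreover have "card (of_nat ` {..<2 * a} :: complex set) = 2 * a"
    by (subst card_image) (auto simp: inj_on_def)
  moreover have "degree (u * p + v * q) < 2 * a"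
    using deg p(1) q(1)
    by (intro degree_add_less order.strict_trans1[OF degree_mult_le]) auto
  ultimately have "u * p + v * q = 0"
    using \<open>0 < a\<close> by (intro poly_eqI_degree[where A = "of_nat ` {..<2 * a}"]) auto
  moreover have "poly p x \<noteq> 0 \<or> poly q x \<noteq> 0" for x
    using no_zero[of "(x, 1)"] form1_affine[OF p(1), of 1 x] form1_affine[OF q(1), of 1 x] p(2) q(2)
    by auto
  moreover have "coeff p a \<noteq> 0 \<or> coeff q a \<noteq> 0"
    using no_zero[of "(1, 0)"] form1_infinity[of a _ 1] p(2) q(2) by auto
  ultimately have uv: "u = 0" "v = 0"
    using no_syzygy_below_degree[OF p(1) q(1) deg] by blast+
  have "coeff u r = c $ r" "coeff v r = c $ (a + r)" if "r < a" for r
    using that by (simp_all add: u_def v_def coeff_sum)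
  then have "c $ r = 0" "c $ (a + r) = 0" if "r < a" for r
    using that uv by (metis coeff_0)+
  then have "c $ r = 0" if "r < 2 * a" for r
    using that by (cases "r < a") (auto dest!: le_Suc_ex simp: not_less)
  then have "c = 0\<^sub>v (2 * a)"
    using c(1) by (intro eq_vecI) auto
  with c(2) show False by simp
qed

text \<open>If there were no common zero, the determinant of the syzygy matrix would vanish for no \<open>y\<close>.  On the
  chart \<open>y = (w, 1)\<close> it is a polynomial in \<open>w\<close>, hence a constant by the fundamental theorem of algebra.
  Being homogeneous of degree \<open>2ab\<close> in \<open>y\<close>, it is then a constant multiple of \<open>w ^ (2ab)\<close> on the
  chart \<open>y = (1, w)\<close>, so that it vanishes at \<open>w = 0\<close>.\<close>

theorem biforms_common_zero:
  assumes FG: "F \<in> biforms a b" "G \<in> biforms a b" and pos: "0 < a" "0 < b"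
  shows "\<exists>x y. x \<noteq> (0, 0) \<and> y \<noteq> (0, 0) \<and> F x y = 0 \<and> G x y = 0"
proof (rule ccontr)
  assume neg: "\<not> ?thesis"
  have ns: "det (syzygy_matrix a F G y) \<noteq> 0" if "y \<noteq> (0, 0)" for y
    by (rule syzygy_matrix_nonsingular[OF FG pos(1)]) (use neg that in blast)
  obtain P Q where P: "bidegree_le P a b" "F = homogenise a b P"
    and Q: "bidegree_le Q a b" "G = homogenise a b Q"
    using FG unfolding biforms_eq_homogenise by blast
  define N where "N = mat (2 * a) (2 * a) (\<lambda>(s, r).
     if r < a then smult (of_nat s ^ r) (poly P [:of_nat s:])
     else smult (of_nat s ^ (r - a)) (poly Q [:of_nat s:]))"
  have aff: "F (x, 1) (w, 1) = poly (poly P [:x:]) w" "G (x, 1) (w, 1) = poly (poly Q [:x:]) w" for x w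
    using homogenise_affine[OF P(1), of 1 1 x w] homogenise_affine[OF Q(1), of 1 1 x w]
    by (simp_all add: P(2) Q(2) eval2_def)
  have poly_det: "poly (det N) w = det (syzygy_matrix a F G (w, 1))" for w
  proof -
    have comm_ring_hom_axioms: "comm_ring_hom (\<lambda>p. poly p w)"
      by unfold_locales auto
    have "map_mat (\<lambda>p. poly p w) N = syzygy_matrix a F G (w, 1)"
      by (intro eq_matI) (auto simp: N_def syzygy_matrix_def aff)
    then show ?thesis
      using comm_ring_hom.hom_det[of "\<lambda>p. poly p w" N] by (simp add: comm_ring_hom_axioms)
  qed
  have "constant (poly (det N))"
    using fundamental_theorem_of_algebra[of "det N"] ns poly_det by fastforce
  then have const: "det (syzygy_matrix a F G (w, 1)) = poly (det N) 0" for w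
    unfolding constant_def by (metis poly_det)
  have "det (syzygy_matrix a F G (1, w)) = w ^ (2 * a * b) * poly (det N) 0" if "w \<noteq> 0" for w
  proof -
    have aff': "F (x, 1) (1, w) = w ^ b * F (x, 1) (1 / w, 1)" "G (x, 1) (1, w) = w ^ b * G (x, 1) (1 / w, 1)" for x
      using homogenise_affine[OF P(1), of 1 w x 1] homogenise_affine[OF Q(1), of 1 w x 1]
        homogenise_affine[OF P(1), of 1 1 x "1 / w"] homogenise_affine[OF Q(1), of 1 1 x "1 / w"] that
      by (simp_all add: P(2) Q(2))
    have "syzygy_matrix a F G (1, w) = w ^ b \<cdot>\<^sub>m syzygy_matrix a F G (1 / w, 1)"
      by (intro eq_matI) (auto simp: syzygy_matrix_def aff')
    then have "det (syzygy_matrix a F G (1, w)) = (w ^ b) ^ (2 * a) * det (syzygy_matrix a F G (1 / w, 1))"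
      by (simp add: syzygy_matrix_def)
    then show ?thesis
      by (simp only: const power_mult[symmetric]) (simp only: mult_ac)
  qed
  moreover have "isCont (\<lambda>w. det (syzygy_matrix a F G (1, w))) 0"
  proof -
    have "isCont (\<lambda>w. syzygy_matrix a F G (1, w) $$ (s, \<pi> s)) 0"
      if "s < 2 * a" "\<pi> permutes {0..<2 * a}" for s \<pi>
      using that permutes_in_image[OF that(2), of s]
      by (cases "\<pi> s < a") (auto simp: syzygy_matrix_def P(2) Q(2) intro!: continuous_intros isCont_homogenise(2))
    then show ?thesis
      unfolding det_def'[of "syzygy_matrix a F G _" "2 * a", simplified syzygy_matrix_def mat_carrier, OF TrueI, folded syzygy_matrix_def]
      by (intro continuous_intros) auto
  qed
  ultimately have "det (syzygy_matrix a F G (1, 0)) = 0 ^ (2 * a * b) * poly (det N) 0"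
    by (intro continuous_eq_at_0[where f = "\<lambda>w. det (syzygy_matrix a F G (1, w))"
        and g = "\<lambda>w. w ^ (2 * a * b) * poly (det N) 0"]) (auto intro!: continuous_intros)
  then show False
    using ns[of "(1, 0)"] pos by simp
qed

section \<open>Regular maps factor through a projection\<close>

lemma biforms_swap:
  assumes "F \<in> biforms a b"
  shows "(\<lambda>x y. F y x) \<in> biforms b a"
proof -
  obtain c where c: "\<And>x0 x1 y0 y1. F (x0, x1) (y0, y1) =
     (\<Sum>i\<le>a. \<Sum>j\<le>b. c i j * (x0 ^ i * x1 ^ (a - i)) * (y0 ^ j * y1 ^ (b - j)))"
    using assms unfolding biforms_def by blast
  have "F (y0, y1) (x0, x1) =
     (\<Sum>i\<le>b. \<Sum>j\<le>a. c j i * (x0 ^ i * x1 ^ (b - i)) * (y0 ^ j * y1 ^ (a - j)))" for x0 x1 y0 y1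
    unfolding c by (subst sum.swap) (intro sum.cong refl, simp)
  then show ?thesis
    unfolding biforms_def mem_Collect_eq by (intro exI[of _ "\<lambda>i j. c j i"]) blast
qed

lemma biform_degree_0_const:
  assumes "F \<in> biforms a 0"
  shows "F x y = F x y'"
proof -
  obtain c where "\<And>x0 x1 y0 y1. F (x0, x1) (y0, y1) =
     (\<Sum>i\<le>a. \<Sum>j\<le>0. c i j * (x0 ^ i * x1 ^ (a - i)) * (y0 ^ j * y1 ^ (0 - j)))"
    using assms unfolding biforms_def by blast
  then show ?thesis
    by (cases x; cases y; cases y') simp
qed

lemma form1_scale: "form1 a p (k * x0, k * x1) = k ^ a * form1 a p (x0, x1)"
proof -
  have "(k * x0) ^ i * (k * x1) ^ (a - i) = k ^ a * (x0 ^ i * x1 ^ (a - i))" if "i \<le> a" for i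
    using that power_add[of k i "a - i"] by (simp add: power_mult_distrib)
  then show ?thesis
    unfolding form1_def prod.case sum_distrib_left by (intro sum.cong refl) simp
qed

text \<open>Any homogeneous coordinates are proportional to the normalised ones.\<close>

lemma hcoord_point:
  assumes "x \<noteq> (0, 0)"
  shows "\<exists>k. k \<noteq> 0 \<and> x = (k * fst (hcoord (point (fst x) (snd x))), k * snd (hcoord (point (fst x) (snd x))))"
  using assms by (cases x; cases "snd x = 0") (auto simp: point_def)

lemma biform_vanishes_at_point:
  assumes "F \<in> biforms a b" "x \<noteq> (0, 0)" "y \<noteq> (0, 0)" "F x y = 0"
  shows "at_pt F (point (fst x) (snd x), point (fst y) (snd y)) = 0"
proof -
  have first: "F' (hcoord (point (fst x) (snd x))) y = 0"
    if F': "F' \<in> biforms a b" and x: "x \<noteq> (0, 0)" and zero: "F' x y = 0" for F' a b x y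
  proof -
    obtain p where p: "\<And>x. F' x y = form1 a p x"
      using biform_slice[OF F', of y] by blast
    obtain k where k: "k \<noteq> 0"
      "x = (k * fst (hcoord (point (fst x) (snd x))), k * snd (hcoord (point (fst x) (snd x))))"
      using hcoord_point[OF x] by blast
    have "form1 a p x = k ^ a * form1 a p (hcoord (point (fst x) (snd x)))"
      by (subst k(2)) (simp only: form1_scale prod.collapse)
    then show ?thesis
      using zero k(1) by (simp add: p)
  qed
  show ?thesis
    using first[OF biforms_swap[OF assms(1)] assms(3) first[OF assms(1,2,4)]]
    by (simp add: at_pt_def)
qed

definition given_by_forms :: "nat \<Rightarrow> complex poly \<Rightarrow> complex poly \<Rightarrow> (P1 \<Rightarrow> P1) \<Rightarrow> bool" where
  "given_by_forms a p q f \<longleftrightarrow> degree p \<le> a \<and> degree q \<le> a \<and>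
     (\<forall>r. (form1 a p (hcoord r), form1 a q (hcoord r)) \<noteq> (0, 0) \<and>
          f r = point (form1 a p (hcoord r)) (form1 a q (hcoord r)))"

theorem regular_map_factors:
  assumes "regular_map f"
  shows "\<exists>a p q g. given_by_forms a p q g \<and> (f = g \<circ> fst \<or> f = g \<circ> snd)"
proof -
  obtain a b F G where F: "F \<in> biforms a b" and G: "G \<in> biforms a b"
    and nz: "\<And>p. (at_pt F p, at_pt G p) \<noteq> (0, 0)" and f: "\<And>p. f p = point (at_pt F p) (at_pt G p)"
    by (rule regular_map_global[OF assms], rule that) assumption+
  have "a = 0 \<or> b = 0"
  proof (rule ccontr)
    assume "\<not> (a = 0 \<or> b = 0)"
    then obtain x y where xy: "x \<noteq> (0, 0)" "y \<noteq> (0, 0)" "F x y = 0" "G x y = 0"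
      using biforms_common_zero[OF F G] by auto
    show False
      using nz[of "(point (fst x) (snd x), point (fst y) (snd y))"]
        biform_vanishes_at_point[OF F xy(1,2,3)] biform_vanishes_at_point[OF G xy(1,2,4)] by simp
  qed
  then show ?thesis
  proof
    assume b: "b = 0"
    obtain p q where pq: "degree p \<le> a" "degree q \<le> a" "\<And>x. F x (1, 0) = form1 a p x" "\<And>x. G x (1, 0) = form1 a q x"
      using F[THEN biform_slice] G[THEN biform_slice] by metis
    have Fy: "F x y = form1 a p x" "G x y = form1 a q x" for x y
      using biform_degree_0_const[of F a x y "(1, 0)"] biform_degree_0_const[of G a x y "(1, 0)"]
        F G b pq by simp_all
    have "given_by_forms a p q (\<lambda>r. point (form1 a p (hcoord r)) (form1 a q (hcoord r)))"
      using pq(1,2) nz by (auto simp: given_by_forms_def at_pt_def Fy)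
    moreover have "f = (\<lambda>r. point (form1 a p (hcoord r)) (form1 a q (hcoord r))) \<circ> fst"
      by (simp add: fun_eq_iff f at_pt_def Fy)
    ultimately show ?thesis by blast
  next
    assume a: "a = 0"
    obtain p q where pq: "degree p \<le> b" "degree q \<le> b" "\<And>x. F (1, 0) x = form1 b p x" "\<And>x. G (1, 0) x = form1 b q x"
      using F[THEN biforms_swap, THEN biform_slice] G[THEN biforms_swap, THEN biform_slice] by metis
    have Fy: "F y x = form1 b p x" "G y x = form1 b q x" for x y
      using biform_degree_0_const[OF biforms_swap[OF F, unfolded a], where x = x and y = y and y' = "(1, 0)"] 
        biform_degree_0_const[OF biforms_swap[OF G, unfolded a], where x = x and y = y and y' = "(1, 0)"] pq by simp_all
    have "given_by_forms b p q (\<lambda>r. point (form1 b p (hcoord r)) (form1 b q (hcoord r)))"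
      using pq(1,2) nz by (auto simp: given_by_forms_def at_pt_def Fy)
    moreover have "f = (\<lambda>r. point (form1 b p (hcoord r)) (form1 b q (hcoord r))) \<circ> snd"
      by (simp add: fun_eq_iff f at_pt_def Fy)
    ultimately show ?thesis by blast
  qed
qed

section \<open>Bijective maps of the line given by forms are Moebius maps\<close>

text \<open>The linear form with \<open>p\<close> as its only zero.\<close>

definition lin_at :: "P1 \<Rightarrow> complex \<times> complex \<Rightarrow> complex" where
  "lin_at p = (\<lambda>(x0, x1). x0 * snd (hcoord p) - x1 * fst (hcoord p))"

text \<open>A form of degree \<open>a\<close> is a product of \<open>a\<close> linear forms, one for each zero counted with
  multiplicity.\<close>

lemma form1_unique_zero:
  assumes deg: "degree q \<le> a" and zero: "\<And>r. form1 a q (hcoord r) = 0 \<longleftrightarrow> r = p"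
  shows "\<exists>\<alpha>. \<alpha> \<noteq> 0 \<and> (\<forall>x. form1 a q x = \<alpha> * lin_at p x ^ a)"
proof -
  have root: "poly q x = 0 \<longleftrightarrow> Aff x = p" for x
    using zero[of "Aff x"] form1_affine[OF deg, of 1 x] by simp
  have inf: "coeff q a = 0 \<longleftrightarrow> Infty = p"
    using zero[of Infty] form1_infinity[of a q 1] by simp
  show ?thesis
  proof (cases p)
    case Infty
    have "constant (poly q)"
      using fundamental_theorem_of_algebra[of q] root Infty by auto
    then obtain c where c: "q = [:c:]"
      by (auto simp: constant_degree elim: degree_eq_zeroE)
    then have "c \<noteq> 0"
      using root[of 0] Infty by auto
    have "form1 a q (x0, x1) = c * x1 ^ a" for x0 x1
    proof -
      have "form1 a q (x0, x1) = (\<Sum>i\<in>{0}. coeff q i * (x0 ^ i * x1 ^ (a - i)))"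
        unfolding form1_def prod.case
        by (rule sum.mono_neutral_right) (auto simp: c coeff_pCons split: nat.splits)
      then show ?thesis by (simp add: c)
    qed
    then have "form1 a q x = (c * (- 1) ^ a) * lin_at p x ^ a" for x
      by (cases x) (simp add: lin_at_def Infty flip: power_mult_distrib)
    then show ?thesis
      using \<open>c \<noteq> 0\<close> by (intro exI[of _ "c * (- 1) ^ a"]) auto
  next
    case (Aff r)
    have "degree q = a"
      using deg inf Aff le_degree[of q a] by auto
    have "{z. poly q z = 0} = {r}"
      using root Aff by auto
    then have "smult (lead_coeff q) ([:- r, 1:] ^ order r q) = q"
      using complex_poly_decompose[of q] by simp
    moreover have "lead_coeff q \<noteq> 0"
      using inf Aff \<open>degree q = a\<close> by simp
    ultimately obtain c n where q: "q = smult c ([:- r, 1:] ^ n)" "c \<noteq> 0"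
      by metis
    then have "n = a"
      using \<open>degree q = a\<close> by (simp add: degree_power_eq)
    have "form1 a q (x0, x1) = c * lin_at p (x0, x1) ^ a" for x0 x1
    proof (cases "x1 = 0")
      case True
      have "coeff q a = c"
        unfolding \<open>degree q = a\<close>[symmetric]
        by (subst (1 2) q(1), unfold lead_coeff_smult lead_coeff_power) simp
      then show ?thesis
        using form1_infinity by (simp add: True lin_at_def Aff)
    next
      case False
      have "x1 ^ a * (x0 / x1 - r) ^ a = (x0 - x1 * r) ^ a"
        using False by (simp add: field_simps flip: power_mult_distrib)
      then show ?thesis
        using form1_affine[OF deg False, of x0] 
        by (simp add: q \<open>n = a\<close> poly_power lin_at_def Aff)
    qed
    then show ?thesis
      using q(2) by (intro exI[of _ c]) auto
  qed
qed

lemma lin_at_exchange: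
  "lin_at p x * lin_at q y - lin_at p y * lin_at q x =
     (fst (hcoord q) * snd (hcoord p) - fst (hcoord p) * snd (hcoord q)) * (fst y * snd x - fst x * snd y)"
  by (simp add: lin_at_def case_prod_unfold algebra_simps)

text \<open>The linear forms of two different points are independent, hence coordinates on \<open>\<complex>\<^sup>2\<close>.\<close>

lemma lin_at_solve:
  assumes "p \<noteq> q"
  shows "\<exists>x. lin_at p x = s \<and> lin_at q x = 1"
proof (cases p)
  case Infty
  then obtain u where u: "q = Aff u" using assms by (cases q) auto
  show ?thesis
    by (rule exI[of _ "(1 - u * s, - s)"]) (simp add: lin_at_def Infty u)
next
  case (Aff r)
  show ?thesis
  proof (cases q)
    case Infty
    show ?thesis
      by (rule exI[of _ "(s - r, - 1)"]) (simp add: lin_at_def Infty Aff)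
  next
    case u: (Aff u)
    have "u - r \<noteq> 0" using assms Aff u by auto
    show ?thesis
      by (rule exI[of _ "(1 + u * ((s - 1) / (u - r)), (s - 1) / (u - r))"])
        (use \<open>u - r \<noteq> 0\<close> in \<open>simp add: lin_at_def Aff u divide_simps, simp add: algebra_simps\<close>)
  qed
qed

lemma given_by_forms_point:
  assumes "given_by_forms a p q f" "x \<noteq> (0, 0)"
  shows "f (point (fst x) (snd x)) = point (form1 a p x) (form1 a q x)"
proof -
  obtain k where k: "k \<noteq> 0"
    "x = (k * fst (hcoord (point (fst x) (snd x))), k * snd (hcoord (point (fst x) (snd x))))"
    using hcoord_point[OF assms(2)] by blast
  have "form1 a r x = k ^ a * form1 a r (hcoord (point (fst x) (snd x)))" for r
    by (subst k(2)) (simp only: form1_scale prod.collapse)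
  then show ?thesis
    using assms(1) k(1) by (simp add: given_by_forms_def point_scale)
qed

definition is_moebius :: "(P1 \<Rightarrow> P1) \<Rightarrow> bool" where
  "is_moebius f \<longleftrightarrow> (\<exists>a b c d. a * d - b * c \<noteq> 0 \<and> f = moebius a b c d)"

text \<open>Numerator and denominator vanish at one point each, so they are \<open>a\<close>-th powers of two independent
  linear forms up to constants.  In these coordinates the map is \<open>x \<mapsto> x ^ a\<close> up to a constant factor,
  which is injective only if \<open>1\<close> is the only \<open>a\<close>-th root of unity.\<close>

theorem bij_given_by_forms_is_moebius:
  assumes rat: "given_by_forms a p q f" and bij: "bij f"
  shows "is_moebius f"
proof -
  have deg: "degree p \<le> a" "degree q \<le> a"
    and nz: "\<And>r. (form1 a p (hcoord r), form1 a q (hcoord r)) \<noteq> (0, 0)"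
    and f: "\<And>r. f r = point (form1 a p (hcoord r)) (form1 a q (hcoord r))"
    using rat by (auto simp: given_by_forms_def)
  have inj: "\<And>r s. f r = f s \<Longrightarrow> r = s"
    using bij by (auto simp: bij_def inj_def)
  obtain z0 zi where z0: "f z0 = Aff 0" and zi: "f zi = Infty"
    using bij by (metis bij_pointE)
  have "form1 a p (hcoord r) = 0 \<longleftrightarrow> r = z0" for r
  proof -
    have "form1 a p (hcoord r) = 0 \<longleftrightarrow> f r = Aff 0"
      using nz[of r] by (auto simp: f point_def)
    then show ?thesis using z0 inj by metis
  qed
  then obtain \<alpha> where \<alpha>: "\<alpha> \<noteq> 0" "\<And>x. form1 a p x = \<alpha> * lin_at z0 x ^ a"
    using form1_unique_zero[OF deg(1)] by blast
  have "form1 a q (hcoord r) = 0 \<longleftrightarrow> r = zi" for r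
  proof -
    have "form1 a q (hcoord r) = 0 \<longleftrightarrow> f r = Infty"
      by (auto simp: f point_def)
    then show ?thesis using zi inj by metis
  qed
  then obtain \<beta> where \<beta>: "\<beta> \<noteq> 0" "\<And>x. form1 a q x = \<beta> * lin_at zi x ^ a"
    using form1_unique_zero[OF deg(2)] by blast
  have "z0 \<noteq> zi"
    using z0 zi by auto
  have root_of_unity: "\<zeta> = 1" if "\<zeta> ^ a = 1" for \<zeta> :: complex
  proof -
    obtain x y where x: "lin_at z0 x = \<zeta>" "lin_at zi x = 1" and y: "lin_at z0 y = 1" "lin_at zi y = 1"
      using lin_at_solve[OF \<open>z0 \<noteq> zi\<close>] by metis
    have nz: "x \<noteq> (0, 0)" "y \<noteq> (0, 0)"
      using x(2) y(2) by (auto simp: lin_at_def)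
    have "f (point (fst x) (snd x)) = f (point (fst y) (snd y))"
      using given_by_forms_point[OF rat nz(1)] given_by_forms_point[OF rat nz(2)] x y that
      by (simp add: \<alpha> \<beta>)
    then have "fst x * snd y = fst y * snd x"
      using inj point_eq_iff[of "fst x" "snd x" "fst y" "snd y"] nz by (auto simp: prod_eq_iff)
    then have "lin_at z0 x * lin_at zi y = lin_at z0 y * lin_at zi x"
      using lin_at_exchange[of z0 x zi y] by simp
    then show ?thesis
      using x y by simp
  qed
  have "a = 1"
  proof (rule ccontr)
    assume "a \<noteq> 1"
    moreover have "a \<noteq> 0"
      using root_of_unity[of 2] by (intro notI) simp
    ultimately have "card {z::complex. z ^ a = 1} \<ge> 2"
      using card_roots_unity_eq[of a] by simp
    moreover have "{z::complex. z ^ a = 1} \<subseteq> {1}"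
      using root_of_unity by auto
    then have "card {z::complex. z ^ a = 1} \<le> 1"
      using card_mono[of "{1::complex}" "{z::complex. z ^ a = 1}"] by simp
    ultimately show False by simp
  qed
  have lin: "form1 a r (x0, x1) = coeff r 1 * x0 + coeff r 0 * x1" for r x0 x1
    by (simp add: form1_def \<open>a = 1\<close>)
  have "coeff p 1 = \<alpha> * snd (hcoord z0)" "coeff p 0 = - \<alpha> * fst (hcoord z0)"
    "coeff q 1 = \<beta> * snd (hcoord zi)" "coeff q 0 = - \<beta> * fst (hcoord zi)"
    using lin[of p 1 0] lin[of p 0 1] lin[of q 1 0] lin[of q 0 1]
      \<alpha>(2)[of "(1, 0)"] \<alpha>(2)[of "(0, 1)"] \<beta>(2)[of "(1, 0)"] \<beta>(2)[of "(0, 1)"]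
    by (simp_all add: \<open>a = 1\<close> lin_at_def)
  then have "coeff p 1 * coeff q 0 - coeff p 0 * coeff q 1 =
      \<alpha> * \<beta> * (fst (hcoord z0) * snd (hcoord zi) - snd (hcoord z0) * fst (hcoord zi))"
    by (simp add: algebra_simps)
  moreover have "fst (hcoord z0) * snd (hcoord zi) - snd (hcoord z0) * fst (hcoord zi) \<noteq> 0"
    using \<open>z0 \<noteq> zi\<close> by (cases z0; cases zi) auto
  ultimately have "coeff p 1 * coeff q 0 - coeff p 0 * coeff q 1 \<noteq> 0"
    using \<alpha>(1) \<beta>(1) by simp
  moreover have "f r = moebius (coeff p 1) (coeff p 0) (coeff q 1) (coeff q 0) r" for r
    by (cases "hcoord r") (simp add: f moebius_def lin)
  ultimately show ?thesis
    unfolding is_moebius_def by blast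
qed

section \<open>Automorphisms of the product of two lines\<close>

lemma phi_T_phi_T: "phi_T \<circ> phi_T = id"
  by (simp add: phi_T_def fun_eq_iff)

text \<open>Both components factor through a projection.  They cannot factor through the same one, because
  then the map would be constant on the fibres of that projection.\<close>

theorem bij_morphism_classification:
  assumes "bij f" "morphism f"
  shows "\<exists>m n. is_moebius m \<and> is_moebius n \<and> (f = map_prod m n \<or> f = map_prod m n \<circ> phi_T)"
proof -
  have inj: "f p = f q \<Longrightarrow> p = q" for p q
    using assms(1) by (simp add: bij_def inj_eq)
  have "regular_map (fst \<circ> f)" "regular_map (snd \<circ> f)"
    using assms(2) by (simp_all add: morphism_def)
  note factors = this[THEN regular_map_factors]
  obtain a p q g where g: "given_by_forms a p q g" "fst \<circ> f = g \<circ> fst \<or> fst \<circ> f = g \<circ> snd"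
    using factors(1) by (elim exE conjE)
  obtain b r s h where h: "given_by_forms b r s h" "snd \<circ> f = h \<circ> fst \<or> snd \<circ> f = h \<circ> snd"
    using factors(2) by (elim exE conjE)
  have bij_components: "bij m \<and> bij n" if "bij (map_prod m n)" for m n :: "P1 \<Rightarrow> P1"
  proof -
    have inj: "inj (map_prod m n)" and surj: "surj (map_prod m n)"
      using that by (auto simp: bij_def)
    have "inj m"
    proof (rule injI)
      fix x y assume "m x = m y"
      then show "x = y" using injD[OF inj, of "(x, Infty)" "(y, Infty)"] by simp
    qed
    moreover have "inj n"
    proof (rule injI)
      fix x y assume "n x = n y"
      then show "x = y" using injD[OF inj, of "(Infty, x)" "(Infty, y)"] by simp
    qed
    moreover have "surj m" "surj n"
    proof -
      have "\<exists>x y. m x = z \<and> n y = z" for z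
        using surjD[OF surj, of "(z, z)"] by (auto simp: eq_commute[of z])
      then show "surj m" "surj n"
        unfolding surj_def by metis+
    qed
    ultimately show ?thesis
      by (simp add: bij_def)
  qed
  have both: False if "\<And>w. fst (f (pr w)) = g0 \<and> snd (f (pr w)) = h0" "pr Infty \<noteq> pr (Aff 0)"
    for pr :: "P1 \<Rightarrow> P1 \<times> P1" and g0 h0
  proof -
    have "f (pr Infty) = f (pr (Aff 0))"
      by (rule prod_eqI) (simp_all only: that(1))
    then show False
      using inj[of "pr Infty" "pr (Aff 0)"] that(2) by simp
  qed
  consider "fst \<circ> f = g \<circ> fst" "snd \<circ> f = h \<circ> snd" | "fst \<circ> f = g \<circ> snd" "snd \<circ> f = h \<circ> fst"
    | "fst \<circ> f = g \<circ> fst" "snd \<circ> f = h \<circ> fst" | "fst \<circ> f = g \<circ> snd" "snd \<circ> f = h \<circ> snd"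
    using g(2) h(2) by argo
  then show ?thesis
  proof cases
    case 1
    then have f: "f = map_prod g h"
      by (auto simp: fun_eq_iff prod_eq_iff)
    then have "bij g" "bij h"
      using bij_components assms(1) by auto
    then show ?thesis
      using f bij_given_by_forms_is_moebius[OF g(1)] bij_given_by_forms_is_moebius[OF h(1)]
      by (intro exI[of _ g] exI[of _ h] conjI) simp_all
  next
    case 2
    then have f: "f = map_prod g h \<circ> phi_T"
      by (auto simp: fun_eq_iff prod_eq_iff phi_T_def)
    have "bij phi_T"
      by (rule o_bij[OF phi_T_phi_T phi_T_phi_T])
    then have "bij (f \<circ> phi_T)"
      using assms(1) by (intro bij_comp)
    moreover have "f \<circ> phi_T = map_prod g h"
      by (simp add: f phi_T_def fun_eq_iff)
    ultimately have "bij (map_prod g h)"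
      by simp
    then have "bij g" "bij h"
      using bij_components by auto
    then show ?thesis
      using f bij_given_by_forms_is_moebius[OF g(1)] bij_given_by_forms_is_moebius[OF h(1)]
      by (intro exI[of _ g] exI[of _ h] conjI) simp_all
  next
    case 3
    then have "fst (f (Infty, w)) = g Infty \<and> snd (f (Infty, w)) = h Infty" for w
      by (simp add: fun_eq_iff)
    then show ?thesis
      using both[of "\<lambda>w. (Infty, w)" "g Infty" "h Infty"] by simp
  next
    case 4
    then have "fst (f (w, Infty)) = g Infty \<and> snd (f (w, Infty)) = h Infty" for w
      by (simp add: fun_eq_iff)
    then show ?thesis
      using both[of "\<lambda>w. (w, Infty)" "g Infty" "h Infty"] by simp
  qed
qed

text \<open>A Moebius map may be evaluated at arbitrary homogeneous coordinates.\<close>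

lemma moebius_point:
  assumes "(X, Y) \<noteq> (0, 0)"
  shows "moebius a b c d (point X Y) = point (a * X + b * Y) (c * X + d * Y)"
proof -
  obtain k where k: "k \<noteq> 0" "X = k * fst (hcoord (point X Y))" "Y = k * snd (hcoord (point X Y))"
    using hcoord_point[OF assms] by auto
  have "a * X + b * Y = k * (a * fst (hcoord (point X Y)) + b * snd (hcoord (point X Y)))"
    "c * X + d * Y = k * (c * fst (hcoord (point X Y)) + d * snd (hcoord (point X Y)))"
    by (subst k(2), subst (2) k(3), simp add: distrib_left mult_ac)+
  then show ?thesis
    using point_scale[OF k(1)] by (simp add: moebius_def case_prod_unfold)
qed

lemma moebius_comp:
  assumes "a * d - b * c \<noteq> 0"
  shows "moebius a' b' c' d' \<circ> moebius a b c d =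
     moebius (a' * a + b' * c) (a' * b + b' * d) (c' * a + d' * c) (c' * b + d' * d)"
proof
  fix p
  show "(moebius a' b' c' d' \<circ> moebius a b c d) p =
     moebius (a' * a + b' * c) (a' * b + b' * d) (c' * a + d' * c) (c' * b + d' * d) p"
    using moebius_point[OF moebius_hcoord_nonzero[OF assms, of p], of a' b' c' d']
    by (simp add: moebius_def case_prod_unfold distrib_left distrib_right mult_ac add_ac)
qed

lemma moebius_scale:
  assumes "e \<noteq> 0"
  shows "moebius (e * a) (e * b) (e * c) (e * d) = moebius a b c d"
proof -
  have "e * u * x + e * v * y = e * (u * x + v * y)" for u v x y
    by (simp add: distrib_left mult.assoc)
  then show ?thesis
    using point_scale[OF assms] by (simp add: fun_eq_iff moebius_def case_prod_unfold)
qed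

lemma moebius_id: "moebius 1 0 0 1 = id"
proof
  fix p show "moebius 1 0 0 1 p = id p"
    by (cases p) (simp_all add: moebius_def point_def)
qed

lemma is_moebius_moebius: "a * d - b * c \<noteq> 0 \<Longrightarrow> is_moebius (moebius a b c d)"
  unfolding is_moebius_def by blast

lemma is_moebius_id: "is_moebius id"
  using is_moebius_moebius[of 1 1 0 0] by (simp add: moebius_id)

lemma is_moebius_comp:
  assumes "is_moebius m" "is_moebius n"
  shows "is_moebius (m \<circ> n)"
proof -
  obtain a b c d where m: "a * d - b * c \<noteq> 0" "m = moebius a b c d"
    using assms(1) by (auto simp: is_moebius_def)
  obtain a' b' c' d' where n: "a' * d' - b' * c' \<noteq> 0" "n = moebius a' b' c' d'"
    using assms(2) by (auto simp: is_moebius_def)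
  have "(a * a' + b * c') * (c * b' + d * d') - (a * b' + b * d') * (c * a' + d * c') =
      (a * d - b * c) * (a' * d' - b' * c')"
    by (simp add: algebra_simps)
  then show ?thesis
    unfolding m(2) n(2) moebius_comp[OF n(1)] using m(1) n(1)
    by (intro is_moebius_moebius) simp
qed

lemma is_moebius_inverse:
  assumes "is_moebius m"
  shows "\<exists>n. is_moebius n \<and> m \<circ> n = id \<and> n \<circ> m = id"
proof -
  obtain a b c d where m: "a * d - b * c \<noteq> 0" "m = moebius a b c d"
    using assms by (auto simp: is_moebius_def)
  have det: "d * a - (- b) * (- c) \<noteq> 0"
    using m(1) by (simp add: mult.commute)
  have "moebius d (- b) (- c) a \<circ> m = id"
    using moebius_inverse[OF m(1)] by (simp add: fun_eq_iff m(2))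
  moreover have "m \<circ> moebius d (- b) (- c) a = id"
    using moebius_inverse[OF det] by (simp add: fun_eq_iff m(2))
  ultimately show ?thesis
    using is_moebius_moebius[OF det] by (intro exI[of _ "moebius d (- b) (- c) a"] conjI)
qed

lemma is_moebius_bij:
  assumes "is_moebius m"
  shows "bij m"
proof -
  obtain n where "m \<circ> n = id" "n \<circ> m = id"
    using is_moebius_inverse[OF assms] by (elim exE conjE)
  then show ?thesis
    by (rule o_bij[rotated])
qed

lemma automorphism_map_prod:
  assumes "is_moebius m" "is_moebius n"
  shows "automorphism (map_prod m n)"
  using assms automorphism_moebius by (auto simp: is_moebius_def)

lemma is_moebius_regular:
  assumes "is_moebius m"
  shows "regular_map (m \<circ> fst)" "regular_map (m \<circ> snd)"
  using assms moebius_regular by (auto simp: is_moebius_def comp_def)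

lemma phi_T_map_prod: "phi_T \<circ> map_prod m n = map_prod n m \<circ> phi_T"
  by (simp add: phi_T_def fun_eq_iff)

lemma automorphism_map_prod_phi_T:
  assumes "is_moebius m" "is_moebius n"
  shows "automorphism (map_prod m n \<circ> phi_T)"
proof -
  obtain m' where m': "is_moebius m'" "m \<circ> m' = id" "m' \<circ> m = id"
    using is_moebius_inverse[OF assms(1)] by blast
  obtain n' where n': "is_moebius n'" "n \<circ> n' = id" "n' \<circ> n = id"
    using is_moebius_inverse[OF assms(2)] by blast
  let ?f = "map_prod m n \<circ> phi_T" and ?g = "map_prod n' m' \<circ> phi_T"
  have "?g (?f p) = p" "?f (?g p) = p" for p
    using m'(2,3) n'(2,3) by (cases p; simp add: phi_T_def fun_eq_iff)+
  then have gf: "?g \<circ> ?f = id" "?f \<circ> ?g = id"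
    by (simp_all add: fun_eq_iff)
  then have "bij ?f"
    by (rule o_bij)
  moreover have "inv_into UNIV ?f = ?g"
    using gf by (intro inv_unique_comp)
  moreover have morph: "morphism (map_prod h k \<circ> phi_T)" if "is_moebius h" "is_moebius k" for h k
  proof -
    have "fst \<circ> (map_prod h k \<circ> phi_T) = h \<circ> snd" "snd \<circ> (map_prod h k \<circ> phi_T) = k \<circ> fst"
      by (simp_all add: fun_eq_iff phi_T_def)
    then show ?thesis
      using is_moebius_regular[OF that(1)] is_moebius_regular[OF that(2)] by (simp add: morphism_def)
  qed
  ultimately show ?thesis
    using morph[OF assms] morph[OF n'(1) m'(1)] by (simp add: automorphism_def)
qed

theorem automorphism_iff:
  "automorphism f \<longleftrightarrow>
     (\<exists>m n. is_moebius m \<and> is_moebius n \<and> (f = map_prod m n \<or> f = map_prod m n \<circ> phi_T))"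
proof
  assume "automorphism f"
  then show "\<exists>m n. is_moebius m \<and> is_moebius n \<and> (f = map_prod m n \<or> f = map_prod m n \<circ> phi_T)"
    by (intro bij_morphism_classification) (simp_all add: automorphism_def)
next
  assume "\<exists>m n. is_moebius m \<and> is_moebius n \<and> (f = map_prod m n \<or> f = map_prod m n \<circ> phi_T)"
  then show "automorphism f"
    using automorphism_map_prod automorphism_map_prod_phi_T by auto
qed

lemma automorphism_comp:
  assumes "automorphism f" "automorphism g"
  shows "automorphism (f \<circ> g)"
proof -
  obtain m n where m: "is_moebius m" "is_moebius n" "f = map_prod m n \<or> f = map_prod m n \<circ> phi_T"
    using assms(1) by (auto simp: automorphism_iff)
  obtain h k where h: "is_moebius h" "is_moebius k" "g = map_prod h k \<or> g = map_prod h k \<circ> phi_T"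
    using assms(2) by (auto simp: automorphism_iff)
  have comp: "map_prod m n \<circ> map_prod h k = map_prod (m \<circ> h) (n \<circ> k)" for h k
    by (simp add: map_prod_compose)
  have "f \<circ> g \<in> {map_prod (m \<circ> h) (n \<circ> k), map_prod (m \<circ> h) (n \<circ> k) \<circ> phi_T,
      map_prod (m \<circ> k) (n \<circ> h), map_prod (m \<circ> k) (n \<circ> h) \<circ> phi_T}"
    using m(3) h(3) by (auto simp: fun_eq_iff phi_T_def)
  then show ?thesis
    using automorphism_map_prod automorphism_map_prod_phi_T is_moebius_comp m(1,2) h(1,2) by auto
qed

text \<open>Closure under composition rests on the classification: regularity of a composition is not
  immediate from the local definition, but Moebius maps compose to Moebius maps.\<close>

lemma group_Aut_pair: "group (Aut_pair S)"
proof (rule groupI)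
  show "x \<otimes>\<^bsub>Aut_pair S\<^esub> y \<in> carrier (Aut_pair S)"
    if "x \<in> carrier (Aut_pair S)" "y \<in> carrier (Aut_pair S)" for x y
  proof -
    have "(x \<circ> y) ` S = x ` y ` S"
      by (rule image_comp[symmetric])
    then show ?thesis
      using that automorphism_comp[of x y] unfolding Aut_pair_def
      by (simp only: partial_object.simps monoid.simps mem_Collect_eq simp_thms)
  qed
  show "\<one>\<^bsub>Aut_pair S\<^esub> \<in> carrier (Aut_pair S)"
    using automorphism_map_prod[OF is_moebius_id is_moebius_id]
    by (simp add: Aut_pair_def map_prod.id)
  show "\<exists>y\<in>carrier (Aut_pair S). y \<otimes>\<^bsub>Aut_pair S\<^esub> x = \<one>\<^bsub>Aut_pair S\<^esub>"
    if "x \<in> carrier (Aut_pair S)" for x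
  proof (rule bexI[of _ "inv_into UNIV x"])
    have x: "bij x" "morphism x" "morphism (inv_into UNIV x)" "x ` S = S"
      using that by (auto simp: Aut_pair_def automorphism_def)
    then show "inv_into UNIV x \<otimes>\<^bsub>Aut_pair S\<^esub> x = \<one>\<^bsub>Aut_pair S\<^esub>"
      by (simp add: Aut_pair_def bij_is_inj)
    have "inv_into UNIV x ` S = S"
      using x(1,4) by (metis bij_is_inj image_inv_f_f)
    then show "inv_into UNIV x \<in> carrier (Aut_pair S)"
      using x by (simp add: Aut_pair_def automorphism_def bij_imp_bij_inv inv_inv_eq)
  qed
qed (auto simp: Aut_pair_def)

section \<open>The Klein four-group of the branch points\<close>

definition branch :: "complex \<Rightarrow> P1 set" where
  "branch lam = {Infty, Aff 0, Aff 1, Aff lam}"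

text \<open>The derivative of \<open>x (x - 1) (x - lam)\<close>.  At a root \<open>k\<close> it is the product \<open>(i - k) (j - k)\<close> over
  the other two roots, which gives the three involutions the uniform shape
  \<open>x \<mapsto> k + cubic_deriv lam k / (x - k)\<close>.\<close>

definition cubic_deriv :: "complex \<Rightarrow> complex \<Rightarrow> complex" where
  "cubic_deriv lam k = 3 * k ^ 2 - 2 * (1 + lam) * k + lam"

lemma beta_Infty: "beta lam Infty = id"
  by (simp add: beta_def)

lemma beta_Aff:
  assumes "k \<in> {0, 1, lam}"
  shows "beta lam (Aff k) = moebius k (cubic_deriv lam k - k ^ 2) 1 (- k)"
  using assms by (auto simp: beta_def cubic_deriv_def power2_eq_square algebra_simps)

lemma cubic_deriv_nonzero:
  assumes "lam \<noteq> 0" "lam \<noteq> 1" "k \<in> {0, 1, lam}"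
  shows "cubic_deriv lam k \<noteq> 0"
proof -
  have "cubic_deriv lam 1 = 1 - lam" "cubic_deriv lam lam = lam * (lam - 1)"
    by (simp_all add: cubic_deriv_def power2_eq_square algebra_simps)
  then show ?thesis
    using assms by (auto simp: cubic_deriv_def)
qed

lemma beta_det:
  assumes "lam \<noteq> 0" "lam \<noteq> 1" "k \<in> {0, 1, lam}"
  shows "k * - k - (cubic_deriv lam k - k ^ 2) * 1 \<noteq> 0"
  using cubic_deriv_nonzero[OF assms] by (simp add: power2_eq_square)

lemma is_moebius_beta:
  assumes "lam \<noteq> 0" "lam \<noteq> 1" "k \<in> branch lam"
  shows "is_moebius (beta lam k)"
proof (cases k)
  case Infty
  then show ?thesis by (simp add: beta_Infty is_moebius_id)
next
  case (Aff a)
  then have "a \<in> {0, 1, lam}"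
    using assms(3) by (auto simp: branch_def)
  then show ?thesis
    unfolding Aff beta_Aff[OF \<open>a \<in> {0, 1, lam}\<close>] using beta_det[OF assms(1,2)] by (intro is_moebius_moebius)
qed

lemma beta_at_Infty: "k \<in> branch lam \<Longrightarrow> beta lam k Infty = k"
  by (auto simp: branch_def beta_Infty beta_Aff moebius_def point_def)

context
  fixes lam :: complex
  assumes lam: "lam \<noteq> 0" "lam \<noteq> 1"
begin

lemma beta_mult:
  "beta lam (Aff 0) \<circ> beta lam (Aff 1) = beta lam (Aff lam)"
  "beta lam (Aff 1) \<circ> beta lam (Aff 0) = beta lam (Aff lam)"
  "beta lam (Aff 0) \<circ> beta lam (Aff lam) = beta lam (Aff 1)"
  "beta lam (Aff lam) \<circ> beta lam (Aff 0) = beta lam (Aff 1)"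
  "beta lam (Aff 1) \<circ> beta lam (Aff lam) = beta lam (Aff 0)"
  "beta lam (Aff lam) \<circ> beta lam (Aff 1) = beta lam (Aff 0)"
proof -
  have d: "cubic_deriv lam 0 = lam" "cubic_deriv lam 1 = 1 - lam" "cubic_deriv lam lam = lam ^ 2 - lam"
    by (simp_all add: cubic_deriv_def power2_eq_square algebra_simps)
  have b: "beta lam (Aff 0) = moebius 0 lam 1 0" "beta lam (Aff 1) = moebius 1 (- lam) 1 (- 1)"
    "beta lam (Aff lam) = moebius lam (- lam) 1 (- lam)"
    using beta_Aff[of _ lam] by (simp_all add: d)
  have nz: "0 * 0 - lam * 1 \<noteq> 0" "1 * - 1 - (- lam) * 1 \<noteq> 0" "lam * - lam - (- lam) * 1 \<noteq> 0"
    using lam by (simp_all add: algebra_simps)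
  note c = moebius_comp[OF nz(1)] moebius_comp[OF nz(2)] moebius_comp[OF nz(3)]
  have sc: "moebius a b c d = moebius a' b' c' d'"
    if "e \<noteq> 0" "a = e * a'" "b = e * b'" "c = e * c'" "d = e * d'" for e a b c d a' b' c' d'
    using moebius_scale[OF that(1), of a' b' c' d'] that(2-) by simp
  show "beta lam (Aff 0) \<circ> beta lam (Aff 1) = beta lam (Aff lam)"
    unfolding b c by (rule sc[of 1]) (use lam in \<open>simp_all add: algebra_simps\<close>)
  show "beta lam (Aff 1) \<circ> beta lam (Aff 0) = beta lam (Aff lam)"
    unfolding b c by (rule sc[of "- 1"]) (use lam in \<open>simp_all add: algebra_simps\<close>)
  show "beta lam (Aff 0) \<circ> beta lam (Aff lam) = beta lam (Aff 1)"
    unfolding b c by (rule sc[of lam]) (use lam in \<open>simp_all add: algebra_simps\<close>)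
  show "beta lam (Aff lam) \<circ> beta lam (Aff 0) = beta lam (Aff 1)"
    unfolding b c by (rule sc[of "- lam"]) (use lam in \<open>simp_all add: algebra_simps\<close>)
  show "beta lam (Aff 1) \<circ> beta lam (Aff lam) = beta lam (Aff 0)"
    unfolding b c by (rule sc[of "lam - 1"]) (use lam in \<open>simp_all add: algebra_simps\<close>)
  show "beta lam (Aff lam) \<circ> beta lam (Aff 1) = beta lam (Aff 0)"
    unfolding b c by (rule sc[of "1 - lam"]) (use lam in \<open>simp_all add: algebra_simps\<close>)
qed

lemma beta_involution:
  assumes "k \<in> branch lam"
  shows "beta lam k (beta lam k x) = x"
proof (cases k)
  case Infty
  then show ?thesis by (simp add: beta_Infty)
next
  case (Aff a)
  then have a: "a \<in> {0, 1, lam}"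
    using assms by (auto simp: branch_def)
  let ?d = "cubic_deriv lam a"
  have "beta lam k \<circ> beta lam k = moebius (?d * 1) (?d * 0) (?d * 0) (?d * 1)"
    unfolding Aff beta_Aff[OF a] moebius_comp[OF beta_det[OF lam a]]
    by (rule arg_cong4[where f = moebius]) (simp_all add: power2_eq_square algebra_simps)
  also have "\<dots> = id"
    using moebius_scale[OF cubic_deriv_nonzero[OF lam a], of 1 0 0 1] moebius_id by simp
  finally show ?thesis
    by (simp add: fun_eq_iff)
qed

lemma beta_commute:
  assumes "k \<in> branch lam" "l \<in> branch lam"
  shows "beta lam k (beta lam l x) = beta lam l (beta lam k x)"
  using assms beta_mult unfolding branch_def fun_eq_iff comp_apply
  by (elim insertE emptyE) (simp_all add: beta_Infty)

lemma beta_branch: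
  assumes "k \<in> branch lam" "l \<in> branch lam"
  shows "beta lam k l \<in> branch lam"
proof -
  have "beta lam k (beta lam l Infty) \<in> branch lam"
  proof (cases "k = Infty \<or> l = Infty \<or> k = l")
    case True
    then consider "k = Infty" | "l = Infty" | "k = l"
      by blast
    then show ?thesis
    proof cases
      case 3
      then show ?thesis
        using beta_involution[OF assms(1)] by (simp add: branch_def)
    qed (use assms in \<open>simp_all add: beta_at_Infty beta_Infty\<close>)
  next
    case False
    then have "\<exists>m\<in>branch lam. beta lam k \<circ> beta lam l = beta lam m"
      using assms beta_mult by (auto simp: branch_def)
    then obtain m where "m \<in> branch lam" "beta lam k (beta lam l Infty) = beta lam m Infty"
      by (auto simp: fun_eq_iff)
    then show ?thesis by (simp add: beta_at_Infty)
  qed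
  then show ?thesis
    using assms(2) by (simp add: beta_at_Infty)
qed

end

section \<open>The fibres of the curve\<close>

lemma beta_Aff_value:
  assumes "k \<in> {0, 1, lam}" "x \<noteq> k"
  shows "beta lam (Aff k) (Aff x) = Aff (k + cubic_deriv lam k / (x - k))"
proof -
  have "(k * x + (cubic_deriv lam k - k ^ 2)) / (x - k) = k + cubic_deriv lam k / (x - k)"
    using assms(2) by (simp add: field_simps power2_eq_square)
  then show ?thesis
    using assms by (simp add: beta_Aff moebius_def point_def)
qed

text \<open>Over a branch point the equation of the curve is the square of a linear form.\<close>

lemma Gamma_fibre_branch:
  assumes "lam \<noteq> 0" "lam \<noteq> 1" "t \<notin> {0, 1, lam}" "k \<in> branch lam"
  shows "(k, w) \<in> Gamma lam t \<longleftrightarrow> w = beta lam k (Aff t)"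
proof -
  have g: "gamma_form lam t (1, 0) (w0, w1) = (t * w1 - w0) ^ 2"
    "gamma_form lam t (0, 1) (w0, w1) = (t * w0 - lam * w1) ^ 2"
    "gamma_form lam t (1, 1) (w0, w1) = ((t - 1) * w0 - (t - lam) * w1) ^ 2"
    "gamma_form lam t (lam, 1) (w0, w1) = ((t - lam) * w0 - lam * (t - 1) * w1) ^ 2" for w0 w1
    by (simp_all add: gamma_form_def power2_eq_square algebra_simps)
  have v: "beta lam (Aff 0) (Aff t) = Aff (lam / t)" "beta lam (Aff 1) (Aff t) = Aff ((t - lam) / (t - 1))"
    "beta lam (Aff lam) (Aff t) = Aff ((lam * t - lam) / (t - lam))"
    using assms by (auto simp: beta_affine)
  show ?thesis
    using assms by (cases w) (auto simp: branch_def beta_Infty v Gamma_def at_pt_def g field_simps)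
qed

text \<open>Over \<open>z = x\<close> the equation is a quadratic form \<open>A w0\<^sup>2 + B w0 w1 + C w1\<^sup>2\<close> whose discriminant is
  nonzero.  For \<open>x = t\<close> the leading coefficient \<open>A\<close> vanishes and one of the two points is \<open>\<infinity>\<close>.\<close>

lemma Gamma_fibre_not_branch:
  assumes "lam \<noteq> 0" "lam \<noteq> 1" "t \<notin> {0, 1, lam}" "z \<notin> branch lam"
  shows "\<exists>v w. v \<noteq> w \<and> (z, v) \<in> Gamma lam t \<and> (z, w) \<in> Gamma lam t"
proof -
  obtain x where z: "z = Aff x" and x: "x \<notin> {0, 1, lam}"
    using assms(4) by (cases z) (auto simp: branch_def)
  define A where "A = (t - x) ^ 2"
  define B where "B = - 2 * t * x ^ 2 - 2 * lam * t + 2 * (2 * (lam + 1) * t - t ^ 2 - lam) * x"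
  define C where "C = (t * x - lam) ^ 2"
  have g: "gamma_form lam t (x, 1) (w0, w1) = A * w0 ^ 2 + B * w0 * w1 + C * w1 ^ 2" for w0 w1
    by (simp add: gamma_form_def A_def B_def C_def power2_eq_square algebra_simps)
  have disc: "B ^ 2 - 4 * A * C = 16 * (t * (t - 1) * (t - lam)) * (x * (x - 1) * (x - lam))"
    unfolding A_def B_def C_def by (simp add: power2_eq_square algebra_simps)
  have "t * (t - 1) * (t - lam) \<noteq> 0" "x * (x - 1) * (x - lam) \<noteq> 0"
    using assms(3) x by auto
  then have disc0: "B ^ 2 - 4 * A * C \<noteq> 0"
    unfolding disc by simp
  show ?thesis
  proof (cases "A = 0")
    case True
    then have "B \<noteq> 0" using disc0 by auto
    then show ?thesis
      by (intro exI[of _ Infty] exI[of _ "Aff (- C / B)"])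
        (simp add: z Gamma_def at_pt_def g True)
  next
    case False
    define s where "s = csqrt (B ^ 2 - 4 * A * C)"
    have s: "s ^ 2 = B ^ 2 - 4 * A * C" "s \<noteq> 0"
      using disc0 by (simp_all add: s_def)
    have root: "(z, Aff ((- B + r) / (2 * A))) \<in> Gamma lam t" if "r ^ 2 = B ^ 2 - 4 * A * C" for r
    proof -
      have "A * ((- B + r) / (2 * A)) ^ 2 + B * ((- B + r) / (2 * A)) + C =
          (r ^ 2 - (B ^ 2 - 4 * A * C)) / (4 * A)"
        using False by (simp add: field_simps power2_eq_square)
      then show ?thesis
        using that by (simp add: z Gamma_def at_pt_def g)
    qed
    have "(- B + s) / (2 * A) \<noteq> (- B + - s) / (2 * A)"
      using s(2) False by (simp add: field_simps)
    then show ?thesis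
      using root[of s] root[of "- s"] s(1)
      by (intro exI[of _ "Aff ((- B + s) / (2 * A))"] exI[of _ "Aff ((- B + - s) / (2 * A))"] conjI) simp_all
  qed
qed

lemma branch_iff_unique_fibre:
  assumes "lam \<noteq> 0" "lam \<noteq> 1" "t \<notin> {0, 1, lam}"
  shows "z \<in> branch lam \<longleftrightarrow> (\<exists>!w. (z, w) \<in> Gamma lam t)"
proof (cases "z \<in> branch lam")
  case True
  then show ?thesis
    by (simp add: Gamma_fibre_branch[OF assms])
next
  case False
  obtain v w where "v \<noteq> w" "(z, v) \<in> Gamma lam t" "(z, w) \<in> Gamma lam t"
    using Gamma_fibre_not_branch[OF assms False] by (elim exE conjE)
  then have "\<not> (\<exists>!w. (z, w) \<in> Gamma lam t)"
    by (auto simp: Ex1_def)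
  with False show ?thesis by simp
qed

lemma Gamma_sym: "(z, w) \<in> Gamma lam t \<longleftrightarrow> (w, z) \<in> Gamma lam t"
  by (cases "hcoord z"; cases "hcoord w") (simp add: Gamma_def at_pt_def gamma_form_def algebra_simps)

text \<open>By \<open>branch_iff_unique_fibre\<close> the branch points are determined by the curve as a set of points, so
  a pair that preserves the curve permutes them and maps the unique point of a fibre over a branch
  point to the corresponding one.\<close>

lemma Gamma_preserving_pair:
  assumes lam: "lam \<noteq> 0" "lam \<noteq> 1" "t \<notin> {0, 1, lam}"
    and bij: "bij m" "bij n" and inv: "map_prod m n ` Gamma lam t = Gamma lam t"
  shows "m z \<in> branch lam \<longleftrightarrow> z \<in> branch lam" "n z \<in> branch lam \<longleftrightarrow> z \<in> branch lam"
    "k \<in> branch lam \<Longrightarrow> n (beta lam k (Aff t)) = beta lam (m k) (Aff t)"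
proof -
  have iff: "(m z, n w) \<in> Gamma lam t \<longleftrightarrow> (z, w) \<in> Gamma lam t" for z w
  proof -
    have "inj (map_prod m n)"
      using bij by (simp add: bij_is_inj prod.inj_map)
    then show ?thesis
      using inj_image_mem_iff[of "map_prod m n" "(z, w)" "Gamma lam t"] inv by simp
  qed
  have ex1_bij: "(\<exists>!w. P (h w)) \<longleftrightarrow> (\<exists>!w. P w)" if h: "bij h" for P and h :: "P1 \<Rightarrow> P1"
  proof
    assume "\<exists>!w. P (h w)"
    then obtain w where w: "P (h w)" "\<And>v. P (h v) \<Longrightarrow> v = w" by blast
    have "u = h w" if "P u" for u
      using w(2) that bij_is_surj[OF h] by (metis surjD)
    with w(1) show "\<exists>!w. P w" by blast
  next
    assume "\<exists>!w. P w"
    then obtain w where w: "P w" "\<And>v. P v \<Longrightarrow> v = w" by blast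
    obtain u where u: "w = h u"
      using bij_is_surj[OF h] by (metis surjD)
    have "v = u" if "P (h v)" for v
      using w(2)[OF that] u bij_is_inj[OF h] by (simp add: inj_eq)
    with w(1) u show "\<exists>!w. P (h w)" by blast
  qed
  show m: "m z \<in> branch lam \<longleftrightarrow> z \<in> branch lam" for z
    unfolding branch_iff_unique_fibre[OF lam] by (subst ex1_bij[OF bij(2), symmetric]) (simp add: iff)
  show "n z \<in> branch lam \<longleftrightarrow> z \<in> branch lam"
    unfolding branch_iff_unique_fibre[OF lam] 
    by (subst ex1_bij[OF bij(1), symmetric]) (simp add: iff Gamma_sym[of "n z"] Gamma_sym[of z])
  show "n (beta lam k (Aff t)) = beta lam (m k) (Aff t)" if "k \<in> branch lam"
    using that m[of k] iff[of k "beta lam k (Aff t)"] Gamma_fibre_branch[OF lam] by blast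
qed

section \<open>Symmetries whose first component fixes infinity\<close>

lemma affine_Infty [simp]: "moebius \<alpha> \<beta> 0 1 Infty = Infty"
  and affine_Aff [simp]: "moebius \<alpha> \<beta> 0 1 (Aff x) = Aff (\<alpha> * x + \<beta>)"
  by (simp_all add: moebius_def point_def)

lemma moebius_fixing_Infty:
  assumes "is_moebius f" "f Infty = Infty"
  shows "\<exists>\<alpha> \<beta>. \<alpha> \<noteq> 0 \<and> f = moebius \<alpha> \<beta> 0 1"
proof -
  obtain a b c d where f: "a * d - b * c \<noteq> 0" "f = moebius a b c d"
    using assms(1) by (auto simp: is_moebius_def)
  have "c = 0"
    using assms(2) by (auto simp: f(2) moebius_def point_def split: if_splits)
  then have ad: "a \<noteq> 0" "d \<noteq> 0"
    using f(1) by auto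
  have "f = moebius (d * (a / d)) (d * (b / d)) (d * 0) (d * 1)"
    using ad by (simp add: f(2) \<open>c = 0\<close>)
  also have "\<dots> = moebius (a / d) (b / d) 0 1"
    by (rule moebius_scale[OF ad(2)])
  finally show ?thesis
    using ad by (intro exI[of _ "a / d"] exI[of _ "b / d"]) simp
qed

text \<open>The six permutations of \<open>0, 1, lam\<close>, with the condition on \<open>lam\<close> under which each of them is
  induced by an affine map.  The 3-cycles exist only for \<open>j\<close>-invariant 0, where
  \<open>lam\<^sup>2 - lam + 1 = 0\<close>; the transpositions need \<open>lam = - 1\<close>, \<open>1/2\<close> or \<open>2\<close>.\<close>

lemma affine_permutation_cases:
  fixes lam :: complex
  assumes "lam \<noteq> 0" "lam \<noteq> 1" "\<alpha> \<noteq> 0"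
    and perm: "\<forall>k\<in>{0, 1, lam}. \<alpha> * k + \<beta> \<in> {0, 1, lam}"
  obtains "\<alpha> = 1" "\<beta> = 0"
    | "\<alpha> = - 1" "\<beta> = 0" "lam = - 1"
    | "\<alpha> = - 1" "\<beta> = 1" "2 * lam = 1"
    | "\<alpha> = - 1" "\<beta> = 2" "lam = 2"
    | "\<alpha> = lam - 1" "\<beta> = 1" "lam ^ 2 - lam + 1 = 0"
    | "\<alpha> = - lam" "\<beta> = lam" "lam ^ 2 - lam + 1 = 0"
proof -
  have "\<beta> \<in> {0, 1, lam}" "\<alpha> + \<beta> \<in> {0, 1, lam}" and l: "\<alpha> * lam + \<beta> \<in> {0, 1, lam}"
    using perm by simp_all
  moreover have "\<alpha> * (lam - 1) \<noteq> 0" "\<alpha> * lam \<noteq> 0"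
    using assms(1-3) by simp_all
  then have "\<alpha> * lam + \<beta> \<noteq> \<beta>" "\<alpha> * lam + \<beta> \<noteq> \<alpha> + \<beta>" "\<alpha> + \<beta> \<noteq> \<beta>"
    using \<open>\<alpha> \<noteq> 0\<close> by (simp_all add: algebra_simps)
  ultimately consider
      "\<beta> = 0" "\<alpha> + \<beta> = 1" | "\<beta> = 0" "\<alpha> + \<beta> = lam" "\<alpha> * lam + \<beta> = 1"
    | "\<beta> = 1" "\<alpha> + \<beta> = 0" "\<alpha> * lam + \<beta> = lam" | "\<beta> = 1" "\<alpha> + \<beta> = lam" "\<alpha> * lam + \<beta> = 0"
    | "\<beta> = lam" "\<alpha> + \<beta> = 0" "\<alpha> * lam + \<beta> = 1" | "\<beta> = lam" "\<alpha> + \<beta> = 1" "\<alpha> * lam + \<beta> = 0"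
    unfolding insert_iff empty_iff by metis
  then show thesis
  proof cases
    case 1
    then show thesis by (intro that(1)) simp_all
  next
    case 2
    then have "(lam - 1) * (lam + 1) = 0" by Groebner_Basis.algebra
    then have "lam = - 1" using assms(2) by (simp add: eq_neg_iff_add_eq_0)
    with 2 show thesis by (intro that(2)) simp_all
  next
    case 3
    then have "\<alpha> = - 1" "2 * lam = 1" by Groebner_Basis.algebra+
    with 3 show thesis by (intro that(3))
  next
    case 4
    then have "\<alpha> = lam - 1" "lam ^ 2 - lam + 1 = 0" by Groebner_Basis.algebra+
    with 4 show thesis by (intro that(5))
  next
    case 5
    then have "\<alpha> = - lam" by (simp add: eq_neg_iff_add_eq_0)
    moreover from 5(3) have "lam ^ 2 - lam + 1 = 0"
      unfolding \<open>\<beta> = lam\<close> \<open>\<alpha> = - lam\<close> by Groebner_Basis.algebra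
    ultimately show thesis using 5(1) by (intro that(6))
  next
    case 6
    then have "\<alpha> = 1 - lam" by (simp add: algebra_simps)
    with 6(1,3) have "(1 - lam) * lam + lam = 0" by simp
    then have "lam * (lam - 2) = 0" by Groebner_Basis.algebra
    then have "lam = 2" using assms(1) by simp
    with 6(1) \<open>\<alpha> = 1 - lam\<close> have "\<alpha> = - 1" "\<beta> = 2" by simp_all
    with \<open>lam = 2\<close> show thesis by (intro that(4))
  qed
qed

text \<open>An affine map \<open>x \<mapsto> \<alpha> x + \<beta>\<close> permuting the roots of the cubic multiplies the cubic by \<open>\<alpha>\<^sup>3\<close>, hence
  its derivative by \<open>\<alpha>\<^sup>2\<close>; comparing matrices gives the claim.\<close>

lemma affine_conjugates_beta:
  assumes lam: "lam \<noteq> 0" "lam \<noteq> 1" and \<alpha>: "\<alpha> \<noteq> 0"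
    and perm: "\<forall>k\<in>{0, 1, lam}. \<alpha> * k + \<beta> \<in> {0, 1, lam}"
    and k: "k \<in> {0, 1, lam}"
  shows "moebius \<alpha> \<beta> 0 1 (beta lam (Aff k) x) = beta lam (Aff (\<alpha> * k + \<beta>)) (moebius \<alpha> \<beta> 0 1 x)"
proof -
  define D where "D = cubic_deriv lam k"
  have D: "cubic_deriv lam (\<alpha> * k + \<beta>) = \<alpha> ^ 2 * D"
    using affine_permutation_cases[OF lam \<alpha> perm]
  proof cases
    case 1
    then show ?thesis by (simp add: D_def)
  qed (use k in \<open>unfold D_def cubic_deriv_def insert_iff empty_iff, elim disjE FalseE; Groebner_Basis.algebra\<close>)+
  have "moebius \<alpha> \<beta> 0 1 \<circ> beta lam (Aff k) =
      moebius (\<alpha> * k + \<beta>) (\<alpha> * (D - k ^ 2) - \<beta> * k) 1 (- k)"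
    unfolding beta_Aff[OF k] moebius_comp[OF beta_det[OF lam k]] by (simp add: D_def)
  also have "\<dots> = moebius (\<alpha> * (\<alpha> * k + \<beta>)) (\<alpha> * (\<alpha> * (D - k ^ 2) - \<beta> * k)) (\<alpha> * 1) (\<alpha> * - k)"
    by (rule moebius_scale[OF \<alpha>, symmetric])
  also have "\<dots> = beta lam (Aff (\<alpha> * k + \<beta>)) \<circ> moebius \<alpha> \<beta> 0 1"
    unfolding beta_Aff[OF perm[rule_format, OF k]] D using \<alpha>
    by (subst moebius_comp) (simp_all add: power2_eq_square algebra_simps)
  finally show ?thesis
    by (simp add: fun_eq_iff)
qed

text \<open>The equation \<open>(t - k)\<^sup>2 = cubic_deriv lam k\<close> says that \<open>t\<close> is a fixed point of \<open>beta lam (Aff k)\<close>.\<close>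

lemma not_exceptional_cubic_deriv:
  assumes "\<not> exceptional lam t" "k \<in> {0, 1, lam}"
  shows "(t - k) ^ 2 \<noteq> cubic_deriv lam k"
  using assms by (auto simp: exceptional_def cubic_deriv_def power2_eq_square algebra_simps)

text \<open>If \<open>beta lam k\<close> and \<open>beta lam l\<close> agree at \<open>t\<close> for \<open>k \<noteq> l\<close>, then their product, which is the third
  involution of the Klein four-group or one of the two, fixes \<open>t\<close>.\<close>

lemma beta_orbit_distinct:
  assumes lam: "lam \<noteq> 0" "lam \<noteq> 1" and t: "t \<notin> {0, 1, lam}" and gen: "\<not> exceptional lam t"
    and kl: "k \<in> branch lam" "l \<in> branch lam" "beta lam k (Aff t) = beta lam l (Aff t)"
  shows "k = l"
proof (rule ccontr)
  assume "k \<noteq> l"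
  have fixed: False if "m \<in> {0, 1, lam}" "beta lam (Aff m) (Aff t) = Aff t" for m
  proof -
    have "t \<noteq> m" using t that(1) by auto
    then have "(t - m) ^ 2 = cubic_deriv lam m"
      using that(2) by (simp add: beta_Aff_value[OF that(1)] field_simps power2_eq_square)
    then show False
      using not_exceptional_cubic_deriv[OF gen that(1)] by simp
  qed
  have returns: "beta lam l (beta lam k (Aff t)) = Aff t"
    using beta_involution[OF lam kl(2)] kl(3) by simp
  have "\<exists>m\<in>{0, 1, lam}. beta lam l \<circ> beta lam k = beta lam (Aff m)"
    using kl(1,2) \<open>k \<noteq> l\<close> beta_mult[OF lam] unfolding branch_def
    by (elim insertE emptyE) (simp_all add: beta_Infty)
  then obtain m where m: "m \<in> {0, 1, lam}" "beta lam l \<circ> beta lam k = beta lam (Aff m)"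
    by blast
  show False
    using fixed[OF m(1)] returns fun_cong[OF m(2), of "Aff t"] by simp
qed

text \<open>For each affine permutation and each finite \<open>p = k\<close> the fixed point equation is a quadratic equation
  for \<open>t\<close>.  In each case it either says that \<open>t\<close> is fixed by one of the involutions, or has only
  roots that are branch points or, for \<open>lam\<^sup>2 - lam + 1 = 0\<close>, one of the exceptional values of \<open>t\<close>.\<close>

lemma affine_beta_fixed_point:
  assumes lam: "lam \<noteq> 0" "lam \<noteq> 1" and t: "t \<notin> {0, 1, lam}" and gen: "\<not> exceptional lam t"
    and \<alpha>: "\<alpha> \<noteq> 0" and perm: "\<forall>k\<in>{0, 1, lam}. \<alpha> * k + \<beta> \<in> {0, 1, lam}"
    and p: "p \<in> branch lam" and fixed: "moebius \<alpha> \<beta> 0 1 (beta lam p (Aff t)) = Aff t"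
  shows "\<alpha> = 1 \<and> \<beta> = 0 \<and> p = Infty"
proof (cases p)
  case Infty
  then have eq: "\<alpha> * t + \<beta> = t"
    using fixed by (simp add: beta_Infty)
  show ?thesis
    using affine_permutation_cases[OF lam \<alpha> perm]
  proof cases
    case 1
    with Infty show ?thesis by simp
  next
    case 2
    then have "2 * t = 0" using eq by Groebner_Basis.algebra
    with t show ?thesis by simp
  next
    case 3
    then have "2 * (t - lam) = 0" using eq by Groebner_Basis.algebra
    with t show ?thesis by simp
  next
    case 4
    then have "2 * (t - 1) = 0" using eq by Groebner_Basis.algebra
    with t show ?thesis by simp
  next
    case 5
    then have "3 * t = 1 + lam" using eq by Groebner_Basis.algebra
    then have "t = (1 + lam) / 3" by (simp add: field_simps)
    with gen 5 show ?thesis by (simp add: exceptional_def)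
  next
    case 6
    then have "3 * t = 1 + lam" using eq by Groebner_Basis.algebra
    then have "t = (1 + lam) / 3" by (simp add: field_simps)
    with gen 6 show ?thesis by (simp add: exceptional_def)
  qed
next
  case (Aff k)
  then have k: "k \<in> {0, 1, lam}"
    using p by (auto simp: branch_def)
  then have "t - k \<noteq> 0"
    using t by auto
  have "\<alpha> * (k + cubic_deriv lam k / (t - k)) + \<beta> = t"
    using fixed \<open>t - k \<noteq> 0\<close> by (simp add: Aff beta_Aff_value[OF k])
  then have "(\<alpha> * k + \<beta>) * (t - k) + \<alpha> * cubic_deriv lam k = t * (t - k)"
    using \<open>t - k \<noteq> 0\<close> by (simp add: field_simps)
  then have eq: "(\<alpha> * k + \<beta>) * (t - k) + \<alpha> * (3 * k ^ 2 - 2 * (1 + lam) * k + lam) = t * (t - k)"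
    by (simp add: cubic_deriv_def)
  have nz: "t \<noteq> 0" "t - 1 \<noteq> 0" "t - lam \<noteq> 0"
    using t by auto
  have ex: "t ^ 2 \<noteq> lam" "(t - 1) ^ 2 \<noteq> 1 - lam" "(t - lam) ^ 2 \<noteq> lam ^ 2 - lam"
    "lam ^ 2 - lam + 1 = 0 \<Longrightarrow> t - (1 + lam) \<noteq> 0" "lam ^ 2 - lam + 1 = 0 \<Longrightarrow> t - (lam - 1) \<noteq> 0"
    "lam ^ 2 - lam + 1 = 0 \<Longrightarrow> t - (1 - lam) \<noteq> 0"
    using gen by (simp_all add: exceptional_def)
  have eq_lam: "(\<alpha> * lam + \<beta>) * (t - lam) + \<alpha> * (3 * lam ^ 2 - 2 * (1 + lam) * lam + lam) = t * (t - lam)"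
    if "k = lam"
    using eq unfolding that .
  have False
    using affine_permutation_cases[OF lam \<alpha> perm]
  proof cases
    case 1
    then have "(t - k) ^ 2 = cubic_deriv lam k"
      using eq unfolding cubic_deriv_def by Groebner_Basis.algebra
    then show ?thesis
      using not_exceptional_cubic_deriv[OF gen k] by simp
  next
    case 2
    consider "k = 0" | "k = 1" | "k = lam" using k by blast
    then show ?thesis
    proof cases
      case 1
      then have "(t - 1) * (t - lam) = 0" using eq 2 by Groebner_Basis.algebra
      then show ?thesis using nz by simp
    next
      case k: 2
      then have "t ^ 2 = lam" using eq 2 by Groebner_Basis.algebra
      then show ?thesis using ex by simp
    next
      case 3
      from eq_lam[OF this] have "t ^ 2 = lam" using 2 by Groebner_Basis.algebra
      then show ?thesis using ex by simp
    qed
  next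
    case 3
    consider "k = 0" | "k = 1" | "k = lam" using k by blast
    then show ?thesis
    proof cases
      case 1
      then have "(t - lam) ^ 2 = lam ^ 2 - lam" using eq 3 by Groebner_Basis.algebra
      then show ?thesis using ex by simp
    next
      case 2
      then have "(t - lam) ^ 2 = lam ^ 2 - lam" using eq 3 by Groebner_Basis.algebra
      then show ?thesis using ex by simp
    next
      case k: 3
      from eq_lam[OF k] have "t * (t - 1) = 0" using 3 by Groebner_Basis.algebra
      then show ?thesis using nz by simp
    qed
  next
    case 4
    consider "k = 0" | "k = 1" | "k = lam" using k by blast
    then show ?thesis
    proof cases
      case 1
      then have "(t - 1) ^ 2 = 1 - lam" using eq 4 by Groebner_Basis.algebra
      then show ?thesis using ex by simp
    next
      case 2
      then have "t * (t - lam) = 0" using eq 4 by Groebner_Basis.algebra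
      then show ?thesis using nz by simp
    next
      case 3
      from eq_lam[OF this] have "(t - 1) ^ 2 = 1 - lam" using 4 by Groebner_Basis.algebra
      then show ?thesis using ex by simp
    qed
  next
    case 5
    consider "k = 0" | "k = 1" | "k = lam" using k by blast
    then show ?thesis
    proof cases
      case 1
      then have "(t - lam) * (t - (1 - lam)) = 0" using eq 5 by Groebner_Basis.algebra
      then show ?thesis using nz ex 5 by simp
    next
      case 2
      then have "t * (t - (1 + lam)) = 0" using eq 5 by Groebner_Basis.algebra
      then show ?thesis using nz ex 5 by simp
    next
      case 3
      from eq_lam[OF this] have "(t - 1) * (t - (lam - 1)) = 0" using 5 by Groebner_Basis.algebra
      then show ?thesis using nz ex 5 by simp
    qed
  next
    case 6
    consider "k = 0" | "k = 1" | "k = lam" using k by blast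
    then show ?thesis
    proof cases
      case 1
      then have "(t - 1) * (t - (lam - 1)) = 0" using eq 6 by Groebner_Basis.algebra
      then show ?thesis using nz ex 6 by simp
    next
      case 2
      then have "(t - lam) * (t - (1 - lam)) = 0" using eq 6 by Groebner_Basis.algebra
      then show ?thesis using nz ex 6 by simp
    next
      case 3
      from eq_lam[OF this] have "t * (t - (1 + lam)) = 0" using 6 by Groebner_Basis.algebra
      then show ?thesis using nz ex 6 by simp
    qed
  qed
  then show ?thesis ..
qed

lemma affine_permutes_branch:
  assumes "\<alpha> \<noteq> 0" "\<forall>z. moebius \<alpha> \<beta> 0 1 z \<in> branch lam \<longleftrightarrow> z \<in> branch lam"
  shows "\<forall>k\<in>{0, 1, lam}. \<alpha> * k + \<beta> \<in> {0, 1, lam}"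
proof
  fix k assume "k \<in> {0, 1, lam}"
  then show "\<alpha> * k + \<beta> \<in> {0, 1, lam}"
    using assms(2)[rule_format, of "Aff k"] by (auto simp: branch_def)
qed

text \<open>With \<open>p\<close> the preimage of \<open>\<infinity>\<close> under \<open>n\<close>, the map \<open>n\<^sub>0 = n \<circ> beta lam p\<close> is affine.  Since \<open>m\<close> fixes
  \<open>\<infinity>\<close>, \<open>n\<close> fixes \<open>t\<close>, that is, \<open>n\<^sub>0\<close> maps \<open>beta lam p t\<close> to \<open>t\<close>.  Comparing the two expressions for
  \<open>n (beta lam k t)\<close> shows that \<open>m\<close> and \<open>n\<^sub>0\<close> agree on \<open>0, 1, lam\<close>, so that they are equal.\<close>

theorem normalised_symmetry_trivial:
  assumes lam: "lam \<noteq> 0" "lam \<noteq> 1" and t: "t \<notin> {0, 1, lam}" and gen: "\<not> exceptional lam t"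
    and m: "is_moebius m" "m Infty = Infty" and n: "is_moebius n"
    and inv: "map_prod m n ` Gamma lam t = Gamma lam t"
  shows "m = id \<and> n = id"
proof -
  note pres = Gamma_preserving_pair[OF lam t is_moebius_bij[OF m(1)] is_moebius_bij[OF n] inv]
  obtain \<alpha> \<beta> where \<alpha>: "\<alpha> \<noteq> 0" "m = moebius \<alpha> \<beta> 0 1"
    using moebius_fixing_Infty[OF m] by blast
  have perm: "\<forall>k\<in>{0, 1, lam}. \<alpha> * k + \<beta> \<in> {0, 1, lam}"
    using affine_permutes_branch[OF \<alpha>(1), of \<beta> lam] pres(1) \<alpha>(2) by simp
  obtain p where p: "n p = Infty"
    using is_moebius_bij[OF n] by (metis bij_pointE)
  have "p \<in> branch lam"
    using pres(2)[of p] by (simp add: p branch_def)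
  define n0 where "n0 = n \<circ> beta lam p"
  have n_n0: "n x = n0 (beta lam p x)" for x
    by (simp add: n0_def beta_involution[OF lam \<open>p \<in> branch lam\<close>])
  have "is_moebius n0"
    unfolding n0_def by (rule is_moebius_comp[OF n is_moebius_beta[OF lam \<open>p \<in> branch lam\<close>]])
  moreover have "n0 Infty = Infty"
    by (simp add: n0_def beta_at_Infty[OF \<open>p \<in> branch lam\<close>] p)
  ultimately obtain \<gamma> \<delta> where \<gamma>: "\<gamma> \<noteq> 0" "n0 = moebius \<gamma> \<delta> 0 1"
    using moebius_fixing_Infty by blast
  have "n0 z \<in> branch lam \<longleftrightarrow> z \<in> branch lam" for z
    using beta_branch[OF lam \<open>p \<in> branch lam\<close>, of z] beta_branch[OF lam \<open>p \<in> branch lam\<close>, of "beta lam p z"]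
      beta_involution[OF lam \<open>p \<in> branch lam\<close>, of z] by (auto simp: n0_def pres(2))
  then have perm0: "\<forall>k\<in>{0, 1, lam}. \<gamma> * k + \<delta> \<in> {0, 1, lam}"
    using affine_permutes_branch[OF \<gamma>(1), of \<delta> lam] \<gamma>(2) by simp
  have fixed: "n0 (beta lam p (Aff t)) = Aff t"
    using pres(3)[of Infty] by (simp add: n_n0 m(2) branch_def beta_Infty)
  have "\<gamma> * k + \<delta> = \<alpha> * k + \<beta>" if k: "k \<in> {0, 1, lam}" for k
  proof -
    have br: "Aff k \<in> branch lam" "Aff (\<alpha> * k + \<beta>) \<in> branch lam" "Aff (\<gamma> * k + \<delta>) \<in> branch lam"
      using k perm[rule_format, OF k] perm0[rule_format, OF k] unfolding branch_def insert_iff empty_iff by simp_all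
    have "beta lam (Aff (\<alpha> * k + \<beta>)) (Aff t) = n (beta lam (Aff k) (Aff t))"
      using pres(3)[OF br(1)] by (simp add: \<alpha>(2))
    also have "\<dots> = n0 (beta lam (Aff k) (beta lam p (Aff t)))"
      by (simp add: n_n0 beta_commute[OF lam \<open>p \<in> branch lam\<close> br(1)])
    also have "\<dots> = beta lam (Aff (\<gamma> * k + \<delta>)) (n0 (beta lam p (Aff t)))"
      unfolding \<gamma>(2) by (rule affine_conjugates_beta[OF lam \<gamma>(1) perm0 k])
    also have "\<dots> = beta lam (Aff (\<gamma> * k + \<delta>)) (Aff t)"
      by (simp add: fixed)
    finally show ?thesis
      using beta_orbit_distinct[OF lam t gen br(2,3)] by simp
  qed
  from this[of 0] this[of 1] have "\<gamma> = \<alpha>" "\<delta> = \<beta>"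
    by simp_all
  then have "moebius \<alpha> \<beta> 0 1 (beta lam p (Aff t)) = Aff t"
    using fixed \<gamma>(2) by simp
  then have "\<alpha> = 1 \<and> \<beta> = 0 \<and> p = Infty"
    using affine_beta_fixed_point[OF lam t gen \<alpha>(1) perm \<open>p \<in> branch lam\<close>] by blast
  then show ?thesis
    using \<alpha>(2) \<gamma>(2) n_n0 \<open>\<gamma> = \<alpha>\<close> \<open>\<delta> = \<beta>\<close> moebius_id by (auto simp: beta_Infty fun_eq_iff)
qed

section \<open>The automorphism group of the pair\<close>

lemma sigma_eq_map_prod: "sigma lam k = map_prod (beta lam k) (beta lam k)"
  by (simp add: sigma_def map_prod_def)

lemma sigma_in_Aut_pair:
  assumes lam: "lam \<noteq> 0" "lam \<noteq> 1" and k: "k \<in> branch lam"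
  shows "sigma lam k \<in> carrier (Aut_pair (Gamma lam t))"
proof (cases k)
  case Infty
  then show ?thesis
    using group.is_monoid[OF group_Aut_pair, THEN monoid.one_closed, of "Gamma lam t"]
    by (simp add: sigma_eq_map_prod beta_Infty map_prod.id Aut_pair_def)
next
  case (Aff a)
  then have a: "a \<in> {0, 1, lam}"
    using k by (auto simp: branch_def)
  let ?d = "cubic_deriv lam a"
  have "gamma_form lam t (a * x0 + (?d - a ^ 2) * x1, 1 * x0 + - a * x1)
      (a * y0 + (?d - a ^ 2) * y1, 1 * y0 + - a * y1) = ?d ^ 2 * gamma_form lam t (x0, x1) (y0, y1)"
    for x0 x1 y0 y1
    using a by (elim insertE emptyE)
      (simp_all add: gamma_form_def cubic_deriv_def power2_eq_square algebra_simps)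
  then show ?thesis
    unfolding sigma_eq_map_prod Aff beta_Aff[OF a]
    using beta_det[OF lam a] cubic_deriv_nonzero[OF lam a]
    by (intro moebius_in_Aut_pair[where e = "?d ^ 2"]) simp_all
qed

text \<open>A pair \<open>(m, n)\<close> preserving the curve is normalised by composing it with \<open>sigma lam k\<close> for
  \<open>k = m \<infinity>\<close>; the composition is trivial, and \<open>sigma lam k\<close> is an involution.\<close>

theorem carrier_Aut_pair_Gamma:
  assumes lam: "lam \<noteq> 0" "lam \<noteq> 1" and t: "t \<notin> {0, 1, lam}" and gen: "\<not> exceptional lam t"
  shows "carrier (Aut_pair (Gamma lam t)) =
     sigma lam ` branch lam \<union> (\<lambda>k. sigma lam k \<circ> phi_T) ` branch lam"
proof
  let ?G = "Aut_pair (Gamma lam t)"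
  interpret G: group ?G by (rule group_Aut_pair)
  have mult: "f \<circ> g \<in> carrier ?G" if "f \<in> carrier ?G" "g \<in> carrier ?G" for f g
    using G.m_closed[OF that] by (simp add: Aut_pair_def)
  show "sigma lam ` branch lam \<union> (\<lambda>k. sigma lam k \<circ> phi_T) ` branch lam \<subseteq> carrier ?G"
    using sigma_in_Aut_pair[OF lam] phi_T_in_Aut_pair mult by blast
  have product: "map_prod m n \<in> sigma lam ` branch lam"
    if m: "is_moebius m" and n: "is_moebius n" and in_G: "map_prod m n \<in> carrier ?G" for m n
  proof -
    have inv: "map_prod m n ` Gamma lam t = Gamma lam t"
      using in_G by (simp add: Aut_pair_def)
    define k where "k = m Infty"
    have "k \<in> branch lam"
      using Gamma_preserving_pair(1)[OF lam t is_moebius_bij[OF m] is_moebius_bij[OF n] inv, of Infty]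
      by (simp add: k_def branch_def)
    have "sigma lam k \<circ> map_prod m n = map_prod (beta lam k \<circ> m) (beta lam k \<circ> n)"
      by (simp add: sigma_eq_map_prod map_prod_compose)
    moreover have "sigma lam k \<circ> map_prod m n \<in> carrier ?G"
      using sigma_in_Aut_pair[OF lam \<open>k \<in> branch lam\<close>] in_G by (rule mult)
    ultimately have "map_prod (beta lam k \<circ> m) (beta lam k \<circ> n) ` Gamma lam t = Gamma lam t"
      by (simp add: Aut_pair_def)
    moreover have "(beta lam k \<circ> m) Infty = Infty"
      using beta_involution[OF lam \<open>k \<in> branch lam\<close>, of Infty] beta_at_Infty[OF \<open>k \<in> branch lam\<close>]
      by (simp flip: k_def)
    moreover have "is_moebius (beta lam k)"
      by (rule is_moebius_beta[OF lam \<open>k \<in> branch lam\<close>])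
    ultimately have "beta lam k \<circ> m = id \<and> beta lam k \<circ> n = id"
      using m n by (intro normalised_symmetry_trivial[OF lam t gen] is_moebius_comp)
    then have "beta lam k (m x) = x" "beta lam k (n x) = x" for x
      by (simp_all add: fun_eq_iff)
    then have "m x = beta lam k x" "n x = beta lam k x" for x
      using beta_involution[OF lam \<open>k \<in> branch lam\<close>] by metis+
    then have "map_prod m n = sigma lam k"
      by (simp add: sigma_eq_map_prod fun_eq_iff)
    then show ?thesis
      using \<open>k \<in> branch lam\<close> by blast
  qed
  show "carrier ?G \<subseteq> sigma lam ` branch lam \<union> (\<lambda>k. sigma lam k \<circ> phi_T) ` branch lam"
  proof
    fix f assume f: "f \<in> carrier ?G"
    then have "automorphism f"
      by (simp add: Aut_pair_def)
    then obtain m n where mn: "is_moebius m" "is_moebius n" "f = map_prod m n \<or> f = map_prod m n \<circ> phi_T"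
      unfolding automorphism_iff by (elim exE conjE)
    show "f \<in> sigma lam ` branch lam \<union> (\<lambda>k. sigma lam k \<circ> phi_T) ` branch lam"
      using mn(3)
    proof
      assume "f = map_prod m n"
      then show ?thesis
        using product[OF mn(1,2)] f by simp
    next
      assume f_eq: "f = map_prod m n \<circ> phi_T"
      then have "f \<circ> phi_T = map_prod m n"
        by (simp add: comp_assoc phi_T_phi_T)
      then have "map_prod m n \<in> carrier ?G"
        using mult[OF f phi_T_in_Aut_pair] by simp
      then have "map_prod m n \<in> sigma lam ` branch lam"
        by (rule product[OF mn(1,2)])
      then show ?thesis
        unfolding f_eq by (elim imageE) simp
    qed
  qed
qed

text \<open>The product \<open>x\<^sup>a y\<^sup>b z\<^sup>c\<close> for exponents 0 and 1.\<close>

definition involution_word :: "'a monoid \<Rightarrow> 'a \<Rightarrow> 'a \<Rightarrow> 'a \<Rightarrow> int \<times> int \<times> int \<Rightarrow> 'a" where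
  "involution_word G x y z = (\<lambda>(a, b, c).
     (if a = 0 then \<one>\<^bsub>G\<^esub> else x) \<otimes>\<^bsub>G\<^esub> ((if b = 0 then \<one>\<^bsub>G\<^esub> else y) \<otimes>\<^bsub>G\<^esub> (if c = 0 then \<one>\<^bsub>G\<^esub> else z)))"

lemma carrier_Z2_cubed: "carrier Z2_cubed = {0, 1} \<times> {0, 1} \<times> {0, 1}"
proof -
  have "{0..<2} = {0, 1::int}" by auto
  then show ?thesis
    by (simp add: Z2_cubed_def DirProd_def integer_mod_group_def)
qed

lemma iso_Z2_cubed:
  assumes "group G" and xyz: "x \<in> carrier G" "y \<in> carrier G" "z \<in> carrier G"
    and sq: "x \<otimes>\<^bsub>G\<^esub> x = \<one>\<^bsub>G\<^esub>" "y \<otimes>\<^bsub>G\<^esub> y = \<one>\<^bsub>G\<^esub>" "z \<otimes>\<^bsub>G\<^esub> z = \<one>\<^bsub>G\<^esub>"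
    and comm: "y \<otimes>\<^bsub>G\<^esub> x = x \<otimes>\<^bsub>G\<^esub> y" "z \<otimes>\<^bsub>G\<^esub> x = x \<otimes>\<^bsub>G\<^esub> z" "z \<otimes>\<^bsub>G\<^esub> y = y \<otimes>\<^bsub>G\<^esub> z"
    and inj: "inj_on (involution_word G x y z) (carrier Z2_cubed)"
    and surj: "involution_word G x y z ` carrier Z2_cubed = carrier G"
  shows "G \<cong> Z2_cubed"
proof -
  interpret G: group G by fact
  let ?h = "involution_word G x y z"
  define X where "X a = (if a = 0 then \<one>\<^bsub>G\<^esub> else x)" for a :: int
  define Y where "Y a = (if a = 0 then \<one>\<^bsub>G\<^esub> else y)" for a :: int
  define Z where "Z a = (if a = 0 then \<one>\<^bsub>G\<^esub> else z)" for a :: int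
  have h: "?h (a, b, c) = X a \<otimes>\<^bsub>G\<^esub> (Y b \<otimes>\<^bsub>G\<^esub> Z c)" for a b c
    by (simp add: involution_word_def X_def Y_def Z_def)
  have closed: "X a \<in> carrier G" "Y a \<in> carrier G" "Z a \<in> carrier G" for a
    using xyz by (simp_all add: X_def Y_def Z_def)
  have comm': "Y b \<otimes>\<^bsub>G\<^esub> X a = X a \<otimes>\<^bsub>G\<^esub> Y b" "Z b \<otimes>\<^bsub>G\<^esub> X a = X a \<otimes>\<^bsub>G\<^esub> Z b"
    "Z b \<otimes>\<^bsub>G\<^esub> Y a = Y a \<otimes>\<^bsub>G\<^esub> Z b" for a b
    using xyz by (simp_all add: X_def Y_def Z_def comm)
  have left_comm: "Y b \<otimes>\<^bsub>G\<^esub> (X a \<otimes>\<^bsub>G\<^esub> u) = X a \<otimes>\<^bsub>G\<^esub> (Y b \<otimes>\<^bsub>G\<^esub> u)"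
    "Z b \<otimes>\<^bsub>G\<^esub> (X a \<otimes>\<^bsub>G\<^esub> u) = X a \<otimes>\<^bsub>G\<^esub> (Z b \<otimes>\<^bsub>G\<^esub> u)"
    "Z b \<otimes>\<^bsub>G\<^esub> (Y a \<otimes>\<^bsub>G\<^esub> u) = Y a \<otimes>\<^bsub>G\<^esub> (Z b \<otimes>\<^bsub>G\<^esub> u)" if "u \<in> carrier G" for a b u
    using that closed by (simp_all add: comm' flip: G.m_assoc)
  have add: "X ((a + a') mod 2) = X a \<otimes>\<^bsub>G\<^esub> X a'" "Y ((a + a') mod 2) = Y a \<otimes>\<^bsub>G\<^esub> Y a'"
    "Z ((a + a') mod 2) = Z a \<otimes>\<^bsub>G\<^esub> Z a'" if "a \<in> {0, 1}" "a' \<in> {0, 1}" for a a'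
    using that xyz by (auto simp: X_def Y_def Z_def sq)
  have "?h (p \<otimes>\<^bsub>Z2_cubed\<^esub> q) = ?h p \<otimes>\<^bsub>G\<^esub> ?h q"
    if p: "p \<in> carrier Z2_cubed" and q: "q \<in> carrier Z2_cubed" for p q
  proof -
    obtain a b c a' b' c' where pq: "p = (a, b, c)" "q = (a', b', c')"
      by (cases p; cases q)
    have "p \<otimes>\<^bsub>Z2_cubed\<^esub> q = ((a + a') mod 2, (b + b') mod 2, (c + c') mod 2)"
      by (simp add: pq Z2_cubed_def DirProd_def integer_mod_group_def)
    moreover have "a \<in> {0, 1}" "b \<in> {0, 1}" "c \<in> {0, 1}" "a' \<in> {0, 1}" "b' \<in> {0, 1}" "c' \<in> {0, 1}"
      using p q unfolding pq carrier_Z2_cubed mem_Sigma_iff by blast+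
    ultimately show ?thesis
      by (simp only: pq h add) (simp add: G.m_assoc closed left_comm)
  qed
  moreover have "?h p \<in> carrier G" for p
    using xyz by (simp add: involution_word_def case_prod_unfold)
  ultimately have "?h \<in> iso Z2_cubed G"
    using inj surj by (auto simp: iso_def hom_def bij_betw_def)
  moreover have "group Z2_cubed"
    unfolding Z2_cubed_def by (intro DirProd_group group_integer_mod_group)
  ultimately show ?thesis
    using group.iso_sym is_isoI by blast
qed

theorem proposition7p2:
  fixes lam t :: complex
  assumes "distinct [0, 1, lam, t]"
    and "\<not> exceptional lam t"
  shows "group (Aut_pair (Gamma lam t)) \<and>
         Aut_pair (Gamma lam t) \<cong> Z2_cubed \<and>
         generate (Aut_pair (Gamma lam t))
           ({sigma lam k | k. k \<in> {Aff 0, Aff 1, Aff lam, Infty}} \<union> {phi_T})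
         = carrier (Aut_pair (Gamma lam t))"
proof (intro conjI)
  let ?G = "Aut_pair (Gamma lam t)"
  have lam: "lam \<noteq> 0" "lam \<noteq> 1" and t: "t \<notin> {0, 1, lam}"
    using assms(1) by auto
  show G: "group ?G"
    by (rule group_Aut_pair)
  interpret G: group ?G by (rule G)
  note carrier = carrier_Aut_pair_Gamma[OF lam t assms(2)]
  have branch: "{sigma lam k | k. k \<in> {Aff 0, Aff 1, Aff lam, Infty}} = sigma lam ` branch lam"
    by (auto simp: branch_def)
  have mult: "f \<otimes>\<^bsub>?G\<^esub> g = f \<circ> g" and one: "\<one>\<^bsub>?G\<^esub> = id" for f g
    by (simp_all add: Aut_pair_def)
  have sigma_in: "sigma lam k \<in> carrier ?G" if "k \<in> branch lam" for k
    using sigma_in_Aut_pair[OF lam that] .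
  show "generate ?G ({sigma lam k | k. k \<in> {Aff 0, Aff 1, Aff lam, Infty}} \<union> {phi_T}) = carrier ?G"
    (is "generate ?G ?S = _")
  proof
    show "generate ?G ?S \<subseteq> carrier ?G"
      unfolding branch using sigma_in phi_T_in_Aut_pair by (intro G.generate_incl) auto
    have "sigma lam k \<in> generate ?G ?S" "phi_T \<in> generate ?G ?S" if "k \<in> branch lam" for k
      unfolding branch using that by (auto intro: generate.incl)
    moreover from this have "sigma lam k \<circ> phi_T \<in> generate ?G ?S" if "k \<in> branch lam" for k
      using that generate.eng[of "sigma lam k" ?G ?S phi_T] by (simp add: mult)
    ultimately show "carrier ?G \<subseteq> generate ?G ?S"
      unfolding carrier by blast
  qed
  let ?x = "sigma lam (Aff 0)" and ?y = "sigma lam (Aff 1)" and ?z = phi_T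
  let ?h = "involution_word ?G ?x ?y ?z"
  have br: "Aff 0 \<in> branch lam" "Aff 1 \<in> branch lam" "Aff lam \<in> branch lam" "Infty \<in> branch lam"
    by (simp_all add: branch_def)
  have sigma_id: "sigma lam Infty = id"
    by (simp add: sigma_eq_map_prod beta_Infty map_prod.id)
  have xy: "?x \<circ> ?y = sigma lam (Aff lam)" "?y \<circ> ?x = sigma lam (Aff lam)"
    using beta_mult[OF lam] by (simp_all add: sigma_eq_map_prod flip: map_prod_compose)
  have h: "?h (0, 0, 0) = sigma lam Infty" "?h (1, 0, 0) = sigma lam (Aff 0)"
    "?h (0, 1, 0) = sigma lam (Aff 1)" "?h (1, 1, 0) = sigma lam (Aff lam)"
    "?h (0, 0, 1) = sigma lam Infty \<circ> phi_T" "?h (1, 0, 1) = sigma lam (Aff 0) \<circ> phi_T"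
    "?h (0, 1, 1) = sigma lam (Aff 1) \<circ> phi_T" "?h (1, 1, 1) = sigma lam (Aff lam) \<circ> phi_T"
    by (simp_all add: involution_word_def mult one sigma_id xy flip: comp_assoc)
  show "?G \<cong> Z2_cubed"
  proof (rule iso_Z2_cubed[OF G])
    show "?x \<in> carrier ?G" "?y \<in> carrier ?G" "?z \<in> carrier ?G"
      using sigma_in br phi_T_in_Aut_pair by auto
    have "sigma lam k \<circ> sigma lam k = id" if "k \<in> branch lam" for k
      using beta_involution[OF lam that] by (simp add: fun_eq_iff sigma_def)
    then show "?x \<otimes>\<^bsub>?G\<^esub> ?x = \<one>\<^bsub>?G\<^esub>" "?y \<otimes>\<^bsub>?G\<^esub> ?y = \<one>\<^bsub>?G\<^esub>"
      using br by (simp_all only: mult one)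
    show "?z \<otimes>\<^bsub>?G\<^esub> ?z = \<one>\<^bsub>?G\<^esub>"
      by (simp only: mult one phi_T_phi_T)
    show "?y \<otimes>\<^bsub>?G\<^esub> ?x = ?x \<otimes>\<^bsub>?G\<^esub> ?y"
      by (simp only: mult xy)
    show "?z \<otimes>\<^bsub>?G\<^esub> ?x = ?x \<otimes>\<^bsub>?G\<^esub> ?z" "?z \<otimes>\<^bsub>?G\<^esub> ?y = ?y \<otimes>\<^bsub>?G\<^esub> ?z"
      by (simp_all only: mult sigma_eq_map_prod phi_T_map_prod)
    show "?h ` carrier Z2_cubed = carrier ?G"
      unfolding carrier carrier_Z2_cubed
      by (simp add: branch_def insert_Times_insert h) blast
    \<comment> \<open>The image of \<open>(\<infinity>, \<infinity>)\<close> determines \<open>k\<close>, and that of \<open>(\<infinity>, 0)\<close> then detects the swap.\<close>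
    have val: "sigma lam k (Infty, Aff 0) = (k, beta lam k (Aff 0))"
      "(sigma lam k \<circ> phi_T) (Infty, Aff 0) = (beta lam k (Aff 0), k)"
      "sigma lam k (Infty, Infty) = (k, k)" "(sigma lam k \<circ> phi_T) (Infty, Infty) = (k, k)"
      if "k \<in> branch lam" for k
      using that by (simp_all add: sigma_def phi_T_def beta_at_Infty)
    have neq: "sigma lam k \<noteq> sigma lam l" "sigma lam k \<circ> phi_T \<noteq> sigma lam l \<circ> phi_T"
      "sigma lam k \<noteq> sigma lam l \<circ> phi_T" "sigma lam k \<circ> phi_T \<noteq> sigma lam l"
      if "k \<in> branch lam" "l \<in> branch lam" "k \<noteq> l" for k l
      using val(3,4)[OF that(1)] val(3,4)[OF that(2)] that(3) by (metis prod.inject)+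
    have neq': "sigma lam k \<noteq> sigma lam k \<circ> phi_T" if "k \<in> branch lam" for k
    proof
      assume "sigma lam k = sigma lam k \<circ> phi_T"
      then have "k = beta lam k (Aff 0)"
        using val(1,2)[OF that] by (metis prod.inject)
      then have "beta lam k k = Aff 0"
        using beta_involution[OF lam that] by metis
      moreover have "beta lam k k = Infty"
        using beta_involution[OF lam that] beta_at_Infty[OF that] by metis
      ultimately show False by simp
    qed
    show "inj_on ?h (carrier Z2_cubed)"
      unfolding carrier_Z2_cubed inj_on_def
      using neq neq' neq'[symmetric] br lam by (auto simp: h)
  qed
qed

end
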